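(* Any pre-geminal category $(\mathcal{B},\mathbb{C},F,\mathbb{H})$ induces code structures on any representable fibration over $\mathcal B$ and on the codomain fibration over $\mathcal{B}$.
   Context: Code structures. For a cloven fibration $p:\mathcal E\to\mathcal B$, $\mathcal E_A$ is the fiber over $A$ and $X\cdot f=f^*(X)$ is reindexing. A global element $a\in_1A$ is a morphism $1\to A$; $f(a)=f\circ a$ and $f(a,b)=f\circ\langle a,b\rangle$. For parallel $f,f':A\to B$ in $\mathcal B$, $f\approx f'$ means that the reindexing functors along $\langle\mathrm{id},f\rangle$ and $\langle\mathrm{id},f'\rangle:A\to A\times B$ are naturally isomorphic. If $\mathcal B$ has binary products and a chosen terminal object $1$, a code structure on $p$ consists of: (i) for each $A$ an object $\ulcorner\mathcal E_A\urcorner$ of $\mathcal B$ and for each $X\in\mathcal E_A$ a global element $\ulcorner X\urcorner\in_1\ulcorner\mathcal E_A\urcorner$; (ii) for each $A,B$ an object $\ulcorner\mathcal B(A,B)\urcorner$ of $\mathcal B$ and for each $f:A\to B$ a global element $\ulcorner f\urcorner\in_1\ulcorner\mathcal B(A,B)\urcorner$; (iii) for each $A,B$ a morphism $\mathsf{app}_{A,B}:\ulcorner\mathcal E_B\urcorner\times\ulcorner\mathcal B(A,B)\urcorner\to\ulcorner\mathcal E_A\urcorner$ with $\mathsf{app}_{A,B}(\ulcorner X\urcorner,\ulcorner f\urcorner)\approx\ulcorner X\cdot f\urcorner$ for all $X\in\mathcal E_B$, $f:A\to B$; (iv) for each $A$ a morphism $\mathsf{code}_A:\ulcorner\mathcal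 E_A\urcorner\to\ulcorner\mathcal B(1,\ulcorner\mathcal E_A\urcorner)\urcorner$ with $\mathsf{code}_A(\ulcorner X\urcorner)\approx\ulcorner\ulcorner X\urcorner\urcorner$ for all $X\in\mathcal E_A$. For $D\in\mathcal B$, the representable fibration $\mathrm{dom}_D:\mathcal B/D\to\mathcal B$ (domain functor from the slice) has fiber over $A$ the discrete category on $\mathcal B(A,D)$, with reindexing by precomposition. The codomain fibration $\mathrm{cod}_{\mathcal B}:\mathcal B^\to\to\mathcal B$ has fiber $\mathcal B/A$ over $A$, with reindexing by the chosen pullbacks of $\mathcal B$. Internal categories. Let $\mathcal B$ be a locally small category with finite limits (a terminal object $1$ and pullbacks). A $\mathcal B$-internal category $\mathbb C$ has an object of objects $|\mathbb C|$, an object of morphisms $|\mathbb C^{\to}|$, morphisms $\mathrm{dom},\mathrm{cod}:|\mathbb C^\to|\to|\mathbb C|$, an identity-assigning morphism and a composition morphism, satisfying the usual axioms. An internal functor $\mathbb H:\mathbb C\to\mathbb D$ is a pair $|\mathbb H|:|\mathbb C|\to|\mathbb D|$, $|\mathbb H^\to|:|\mathbb C^\to|\to|\mathbb D^\to|$ commuting with this structure. A global object $X\in_1\mathbb C$ is a morphism $X:1\to|\mathbb C|$; $\mathbb HX=|\mathbb H|\circ X$. The hom-object $\mathbb C(X,Y)$ is the pullback of $\langle\mathrm{dom},\mathrm{cod}\rangle:|\mathbb C^\to|\to|\mathbb C|\times|\mathbb C|$ along $\langle X,Y\rangle$; its global elements are identified with global elements of $|\mathbb C^\to|$ with domain $X$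 and codomain $Y$. The underlying category $\Gamma\mathbb C$ has global objects as objects and global elements of $\mathbb C(X,Y)$ as morphisms $X\to Y$; an internal functor $\mathbb H$ induces a functor $\Gamma\mathbb H$. $\mathbb C$ has chosen finite limits if it is equipped with an internal chosen terminal object $1_{\mathbb C}\in_1\mathbb C$ and internal chosen pullbacks (morphisms of $\mathcal B$ expressing a choice of pullback squares on the object of cospans and of mediating arrows, satisfying the evident internal equations); then $\Gamma\mathbb C$ has induced chosen finite limits. The global section functor is $\gamma_{\mathbb C}=\mathbb C(1_{\mathbb C},-):\Gamma\mathbb C\to\mathcal B$ (acting on morphisms by composition in $\mathbb C$); it preserves finite limits. If $G:\mathcal B\to\mathcal B'$ preserves finite limits, $G\mathbb C$ is the $\mathcal B'$-internal category obtained by applying $G$ to all data of $\mathbb C$, and $G^{\#}_{\mathbb C}:\Gamma\mathbb C\to\Gamma G\mathbb C$ is the functor sending a global object $X$ to $1\cong G1\xrightarrow{GX}G|\mathbb C|$, and likewise on global morphisms. Pre-geminal category. It consists of: (I) a category $\mathcal B$ with chosen finite limits; (II) a $\mathcal B$-internal category $\mathbb C$ with chosen finite limits; (III) a functor $F:\mathcal B\to\Gamma\mathbb C$ strictly preserving the chosen finite limits; put $\Box=\gamma_{\mathbb C}\circ F:\mathcal B\to\mathcal B$, which preserves finite limits; (IV) a $\mathcal B$-internal functor $\mathbb H:\mathbb C\to\Box\mathbb C$ satisfying $\Gamma\mathbb H\circ F=F^{\#}_{\mathbb C}\circ F$, where the codomain $\Gamma F\mathbb C$ of $F^{\#}_{\mathbb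 C}$ is identified with $\Gamma\Box\mathbb C=\Gamma\gamma_{\mathbb C}F\mathbb C$ by the canonical isomorphism. *)

theory Defs
  imports Main
begin

section \<open>Categories, functors, natural isomorphisms\<close>

record ('o, 'm) cat =
  Ob :: "'o set"
  Mor :: "'m set"
  Dom :: "'m \<Rightarrow> 'o"
  Cod :: "'m \<Rightarrow> 'o"
  Idn :: "'o \<Rightarrow> 'm"
  Comp :: "'m \<Rightarrow> 'm \<Rightarrow> 'm"

definition hom :: "('o, 'm, 'z) cat_scheme \<Rightarrow> 'o \<Rightarrow> 'o \<Rightarrow> 'm set" where
  "hom C A B = {f \<in> Mor C. Dom C f = A \<and> Cod C f = B}"

definition category :: "('o, 'm, 'z) cat_scheme \<Rightarrow> bool" where
  "category C \<longleftrightarrow>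
     (\<forall>f\<in>Mor C. Dom C f \<in> Ob C \<and> Cod C f \<in> Ob C) \<and>
     (\<forall>A\<in>Ob C. Idn C A \<in> hom C A A) \<and>
     (\<forall>f\<in>Mor C. \<forall>g\<in>Mor C. Cod C f = Dom C g \<longrightarrow> Comp C g f \<in> hom C (Dom C f) (Cod C g)) \<and>
     (\<forall>f\<in>Mor C. Comp C (Idn C (Cod C f)) f = f \<and> Comp C f (Idn C (Dom C f)) = f) \<and>
     (\<forall>f\<in>Mor C. \<forall>g\<in>Mor C. \<forall>h\<in>Mor C. Cod C f = Dom C g \<longrightarrow> Cod C g = Dom C h \<longrightarrow>
        Comp C (Comp C h g) f = Comp C h (Comp C g f))"

definition iso :: "('o, 'm, 'z) cat_scheme \<Rightarrow> 'm \<Rightarrow> bool" where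
  "iso C f \<longleftrightarrow> f \<in> Mor C \<and>
     (\<exists>g \<in> hom C (Cod C f) (Dom C f).
        Comp C g f = Idn C (Dom C f) \<and> Comp C f g = Idn C (Cod C f))"

record ('o, 'm, 'p, 'n) func =
  Fo :: "'o \<Rightarrow> 'p"
  Fm :: "'m \<Rightarrow> 'n"

definition is_functor ::
  "('o, 'm, 'z) cat_scheme \<Rightarrow> ('p, 'n, 'y) cat_scheme \<Rightarrow> ('o, 'm, 'p, 'n) func \<Rightarrow> bool" where
  "is_functor C D F \<longleftrightarrow>
     (\<forall>A\<in>Ob C. Fo F A \<in> Ob D) \<and>
     (\<forall>f\<in>Mor C. Fm F f \<in> hom D (Fo F (Dom C f)) (Fo F (Cod C f))) \<and>
     (\<forall>A\<in>Ob C. Fm F (Idn C A) = Idn D (Fo F A)) \<and>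
     (\<forall>f\<in>Mor C. \<forall>g\<in>Mor C. Cod C f = Dom C g \<longrightarrow>
        Fm F (Comp C g f) = Comp D (Fm F g) (Fm F f))"

definition naturally_isomorphic ::
  "('o, 'm, 'z) cat_scheme \<Rightarrow> ('p, 'n, 'y) cat_scheme \<Rightarrow>
   ('o, 'm, 'p, 'n) func \<Rightarrow> ('o, 'm, 'p, 'n) func \<Rightarrow> bool" where
  "naturally_isomorphic C D S T \<longleftrightarrow>
     (\<exists>\<eta>. (\<forall>A\<in>Ob C. \<eta> A \<in> hom D (Fo S A) (Fo T A) \<and> iso D (\<eta> A)) \<and>
          (\<forall>f\<in>Mor C. Comp D (Fm T f) (\<eta> (Dom C f)) = Comp D (\<eta> (Cod C f)) (Fm S f)))"


section \<open>Chosen finite limits\<close>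

record ('o, 'm) tcat = "('o, 'm) cat" +
  One :: 'o

text \<open>\<open>Pb1 B f g\<close> and \<open>Pb2 B f g\<close> are the projections, to \<open>Dom B f\<close> and \<open>Dom B g\<close>
  respectively, of the chosen pullback of the cospan \<open>(f, g)\<close>; its apex is their common domain.\<close>

record ('o, 'm) flcat = "('o, 'm) tcat" +
  Pb1 :: "'m \<Rightarrow> 'm \<Rightarrow> 'm"
  Pb2 :: "'m \<Rightarrow> 'm \<Rightarrow> 'm"

definition terminal :: "('o, 'm, 'z) cat_scheme \<Rightarrow> 'o \<Rightarrow> bool" where
  "terminal C T \<longleftrightarrow> T \<in> Ob C \<and> (\<forall>A\<in>Ob C. \<exists>!m. m \<in> hom C A T)"

definition is_product :: "('o, 'm, 'z) cat_scheme \<Rightarrow> 'o \<Rightarrow> 'o \<Rightarrow> 'm \<Rightarrow> 'm \<Rightarrow> bool" where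
  "is_product C A B p q \<longleftrightarrow>
     p \<in> hom C (Dom C p) A \<and> q \<in> hom C (Dom C p) B \<and>
     (\<forall>I\<in>Ob C. \<forall>f\<in>hom C I A. \<forall>g\<in>hom C I B.
        \<exists>!m. m \<in> hom C I (Dom C p) \<and> Comp C p m = f \<and> Comp C q m = g)"

definition is_pullback :: "('o, 'm, 'z) cat_scheme \<Rightarrow> 'm \<Rightarrow> 'm \<Rightarrow> 'm \<Rightarrow> 'm \<Rightarrow> bool" where
  "is_pullback C f g p q \<longleftrightarrow>
     p \<in> hom C (Dom C p) (Dom C f) \<and> q \<in> hom C (Dom C p) (Dom C g) \<and>
     Comp C f p = Comp C g q \<and>
     (\<forall>I\<in>Ob C. \<forall>h\<in>hom C I (Dom C f). \<forall>k\<in>hom C I (Dom C g). Comp C f h = Comp C g k \<longrightarrow>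
        (\<exists>!m. m \<in> hom C I (Dom C p) \<and> Comp C p m = h \<and> Comp C q m = k))"

definition has_chosen_finite_limits :: "('o, 'm, 'z) flcat_scheme \<Rightarrow> bool" where
  "has_chosen_finite_limits B \<longleftrightarrow>
     category B \<and> terminal B (One B) \<and>
     (\<forall>f\<in>Mor B. \<forall>g\<in>Mor B. Cod B f = Cod B g \<longrightarrow> is_pullback B f g (Pb1 B f g) (Pb2 B f g))"

definition bang :: "('o, 'm, 'z) tcat_scheme \<Rightarrow> 'o \<Rightarrow> 'm" where
  "bang B A = (THE m. m \<in> hom B A (One B))"

definition med :: "('o, 'm, 'z) flcat_scheme \<Rightarrow> 'm \<Rightarrow> 'm \<Rightarrow> 'm \<Rightarrow> 'm \<Rightarrow> 'm" where
  "med B f g h k = (THE m. m \<in> hom B (Dom B h) (Dom B (Pb1 B f g)) \<and>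
     Comp B (Pb1 B f g) m = h \<and> Comp B (Pb2 B f g) m = k)"

text \<open>Binary products given by a choice of projections \<open>p A B\<close>, \<open>q A B\<close>.\<close>

definition has_products ::
  "('o, 'm, 'z) cat_scheme \<Rightarrow> ('o \<Rightarrow> 'o \<Rightarrow> 'm) \<Rightarrow> ('o \<Rightarrow> 'o \<Rightarrow> 'm) \<Rightarrow> bool" where
  "has_products C p q \<longleftrightarrow> (\<forall>A\<in>Ob C. \<forall>B\<in>Ob C. is_product C A B (p A B) (q A B))"

definition pairing ::
  "('o, 'm, 'z) cat_scheme \<Rightarrow> ('o \<Rightarrow> 'o \<Rightarrow> 'm) \<Rightarrow> ('o \<Rightarrow> 'o \<Rightarrow> 'm) \<Rightarrow> 'm \<Rightarrow> 'm \<Rightarrow> 'm" where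
  "pairing C p q f g =
     (let A = Cod C f; B = Cod C g
      in THE m. m \<in> hom C (Dom C f) (Dom C (p A B)) \<and> Comp C (p A B) m = f \<and> Comp C (q A B) m = g)"

text \<open>With chosen finite limits, the product of two objects is their chosen pullback over the
  chosen terminal object.\<close>

definition Pr1 :: "('o, 'm, 'z) flcat_scheme \<Rightarrow> 'o \<Rightarrow> 'o \<Rightarrow> 'm" where
  "Pr1 B X Y = Pb1 B (bang B X) (bang B Y)"

definition Pr2 :: "('o, 'm, 'z) flcat_scheme \<Rightarrow> 'o \<Rightarrow> 'o \<Rightarrow> 'm" where
  "Pr2 B X Y = Pb2 B (bang B X) (bang B Y)"

definition tup :: "('o, 'm, 'z) flcat_scheme \<Rightarrow> 'm \<Rightarrow> 'm \<Rightarrow> 'm" where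
  "tup B f g = pairing B (Pr1 B) (Pr2 B) f g"

definition strictly_preserves_finite_limits ::
  "('o, 'm, 'z) flcat_scheme \<Rightarrow> ('p, 'n, 'y) flcat_scheme \<Rightarrow> ('o, 'm, 'p, 'n) func \<Rightarrow> bool" where
  "strictly_preserves_finite_limits B B' F \<longleftrightarrow>
     Fo F (One B) = One B' \<and>
     (\<forall>f\<in>Mor B. \<forall>g\<in>Mor B. Cod B f = Cod B g \<longrightarrow>
        Fm F (Pb1 B f g) = Pb1 B' (Fm F f) (Fm F g) \<and>
        Fm F (Pb2 B f g) = Pb2 B' (Fm F f) (Fm F g))"


section \<open>Cloven fibrations and code structures\<close>

text \<open>\<open>Lift p f X\<close> is the chosen cartesian morphism over \<open>f\<close> with codomain \<open>X\<close>.\<close>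

record ('o, 'm, 'x, 'y) cloven =
  Tot :: "('x, 'y) cat"
  Prj :: "('x, 'y, 'o, 'm) func"
  Lift :: "'m \<Rightarrow> 'x \<Rightarrow> 'y"

definition cartesian ::
  "('o, 'm, 'z) cat_scheme \<Rightarrow> ('o, 'm, 'x, 'y) cloven \<Rightarrow> 'y \<Rightarrow> bool" where
  "cartesian B p \<phi> \<longleftrightarrow> \<phi> \<in> Mor (Tot p) \<and>
     (\<forall>\<psi>\<in>Mor (Tot p). \<forall>h\<in>hom B (Fo (Prj p) (Dom (Tot p) \<psi>)) (Fo (Prj p) (Dom (Tot p) \<phi>)).
        Cod (Tot p) \<psi> = Cod (Tot p) \<phi> \<and> Comp B (Fm (Prj p) \<phi>) h = Fm (Prj p) \<psi> \<longrightarrow>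
        (\<exists>!\<chi>. \<chi> \<in> hom (Tot p) (Dom (Tot p) \<psi>) (Dom (Tot p) \<phi>) \<and>
              Fm (Prj p) \<chi> = h \<and> Comp (Tot p) \<phi> \<chi> = \<psi>))"

definition cloven_fibration ::
  "('o, 'm, 'z) cat_scheme \<Rightarrow> ('o, 'm, 'x, 'y) cloven \<Rightarrow> bool" where
  "cloven_fibration B p \<longleftrightarrow>
     category B \<and> category (Tot p) \<and> is_functor (Tot p) B (Prj p) \<and>
     (\<forall>f\<in>Mor B. \<forall>X\<in>Ob (Tot p). Fo (Prj p) X = Cod B f \<longrightarrow>
        cartesian B p (Lift p f X) \<and> Cod (Tot p) (Lift p f X) = X \<and>
        Fm (Prj p) (Lift p f X) = f)"

definition fiber ::
  "('o, 'm, 'z) cat_scheme \<Rightarrow> ('o, 'm, 'x, 'y) cloven \<Rightarrow> 'o \<Rightarrow> ('x, 'y) cat" where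
  "fiber B p A = \<lparr>Ob = {X \<in> Ob (Tot p). Fo (Prj p) X = A},
                  Mor = {v \<in> Mor (Tot p). Fm (Prj p) v = Idn B A},
                  Dom = Dom (Tot p), Cod = Cod (Tot p), Idn = Idn (Tot p), Comp = Comp (Tot p)\<rparr>"

definition reindex ::
  "('o, 'm, 'z) cat_scheme \<Rightarrow> ('o, 'm, 'x, 'y) cloven \<Rightarrow> 'm \<Rightarrow> ('x, 'y, 'x, 'y) func" where
  "reindex B p f =
     \<lparr>Fo = (\<lambda>X. Dom (Tot p) (Lift p f X)),
      Fm = (\<lambda>v. let X = Dom (Tot p) v; Y = Cod (Tot p) v in
              THE \<chi>. \<chi> \<in> hom (Tot p) (Dom (Tot p) (Lift p f X)) (Dom (Tot p) (Lift p f Y)) \<and>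
                Fm (Prj p) \<chi> = Idn B (Dom B f) \<and>
                Comp (Tot p) (Lift p f Y) \<chi> = Comp (Tot p) v (Lift p f X))\<rparr>"

definition approx ::
  "('o, 'm, 'z) cat_scheme \<Rightarrow> ('o \<Rightarrow> 'o \<Rightarrow> 'm) \<Rightarrow> ('o \<Rightarrow> 'o \<Rightarrow> 'm) \<Rightarrow>
   ('o, 'm, 'x, 'y) cloven \<Rightarrow> 'm \<Rightarrow> 'm \<Rightarrow> bool" where
  "approx B pr1 pr2 p f f' \<longleftrightarrow>
     f \<in> Mor B \<and> f' \<in> hom B (Dom B f) (Cod B f) \<and>
     (let A = Dom B f; P = Dom B (pr1 A (Cod B f))
      in naturally_isomorphic (fiber B p P) (fiber B p A)
           (reindex B p (pairing B pr1 pr2 (Idn B A) f))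
           (reindex B p (pairing B pr1 pr2 (Idn B A) f')))"

text \<open>\<open>EO A\<close> and \<open>EC A X\<close> are the object of codes for the fiber over \<open>A\<close> and the code of
  \<open>X\<close> in that fiber; \<open>HO A A'\<close> and \<open>HC A A' f\<close> are the object of codes for the morphisms from
  \<open>A\<close> to \<open>A'\<close> and the code of \<open>f : A \<rightarrow> A'\<close>.\<close>

record ('o, 'm, 'x) codes =
  EO :: "'o \<Rightarrow> 'o"
  EC :: "'o \<Rightarrow> 'x \<Rightarrow> 'm"
  HO :: "'o \<Rightarrow> 'o \<Rightarrow> 'o"
  HC :: "'o \<Rightarrow> 'o \<Rightarrow> 'm \<Rightarrow> 'm"
  App :: "'o \<Rightarrow> 'o \<Rightarrow> 'm"
  Code :: "'o \<Rightarrow> 'm"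

definition code_structure ::
  "('o, 'm, 'z) tcat_scheme \<Rightarrow> ('o \<Rightarrow> 'o \<Rightarrow> 'm) \<Rightarrow> ('o \<Rightarrow> 'o \<Rightarrow> 'm) \<Rightarrow>
   ('o, 'm, 'x, 'y) cloven \<Rightarrow> ('o, 'm, 'x) codes \<Rightarrow> bool" where
  "code_structure B pr1 pr2 p S \<longleftrightarrow>
     cloven_fibration B p \<and> terminal B (One B) \<and> has_products B pr1 pr2 \<and>
     (\<forall>A\<in>Ob B. EO S A \<in> Ob B \<and>
        (\<forall>X\<in>Ob (fiber B p A). EC S A X \<in> hom B (One B) (EO S A))) \<and>
     (\<forall>A\<in>Ob B. \<forall>A'\<in>Ob B. HO S A A' \<in> Ob B \<and>
        (\<forall>f\<in>hom B A A'. HC S A A' f \<in> hom B (One B) (HO S A A'))) \<and>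
     (\<forall>A\<in>Ob B. \<forall>A'\<in>Ob B.
        App S A A' \<in> hom B (Dom B (pr1 (EO S A') (HO S A A'))) (EO S A) \<and>
        (\<forall>X\<in>Ob (fiber B p A'). \<forall>f\<in>hom B A A'.
           approx B pr1 pr2 p
             (Comp B (App S A A') (pairing B pr1 pr2 (EC S A' X) (HC S A A' f)))
             (EC S A (Fo (reindex B p f) X)))) \<and>
     (\<forall>A\<in>Ob B.
        Code S A \<in> hom B (EO S A) (HO S (One B) (EO S A)) \<and>
        (\<forall>X\<in>Ob (fiber B p A).
           approx B pr1 pr2 p
             (Comp B (Code S A) (EC S A X))
             (HC S (One B) (EO S A) (EC S A X))))"


section \<open>Representable and codomain fibrations\<close>

text \<open>A morphism of the slice over \<open>D\<close> is a commuting triangle \<open>(g, h, g')\<close> with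
  \<open>g' \<circ> h = g\<close>; the source and target are recorded so that they can be recovered.\<close>

definition slice :: "('o, 'm, 'z) cat_scheme \<Rightarrow> 'o \<Rightarrow> ('m, 'm \<times> 'm \<times> 'm) cat" where
  "slice B D = \<lparr>Ob = {g \<in> Mor B. Cod B g = D},
     Mor = {(g, h, g'). g \<in> Mor B \<and> g' \<in> Mor B \<and> Cod B g = D \<and> Cod B g' = D \<and>
              h \<in> hom B (Dom B g) (Dom B g') \<and> Comp B g' h = g},
     Dom = (\<lambda>(g, h, g'). g), Cod = (\<lambda>(g, h, g'). g'),
     Idn = (\<lambda>g. (g, Idn B (Dom B g), g)),
     Comp = (\<lambda>(g1, h, g2) (g0, k, g1'). (g0, Comp B h k, g2))\<rparr>"

definition dom_fibration ::
  "('o, 'm, 'z) cat_scheme \<Rightarrow> 'o \<Rightarrow> ('o, 'm, 'm, 'm \<times> 'm \<times> 'm) cloven" where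
  "dom_fibration B D = \<lparr>Tot = slice B D,
     Prj = \<lparr>Fo = Dom B, Fm = (\<lambda>(g, h, g'). h)\<rparr>,
     Lift = (\<lambda>f X. (Comp B X f, f, X))\<rparr>"

text \<open>A morphism of the arrow category from \<open>g\<close> to \<open>g'\<close> is a commuting square
  \<open>(g, u, v, g')\<close> with \<open>g' \<circ> u = v \<circ> g\<close>.\<close>

definition arrow_cat :: "('o, 'm, 'z) cat_scheme \<Rightarrow> ('m, 'm \<times> 'm \<times> 'm \<times> 'm) cat" where
  "arrow_cat B = \<lparr>Ob = Mor B,
     Mor = {(g, u, v, g'). g \<in> Mor B \<and> g' \<in> Mor B \<and>
              u \<in> hom B (Dom B g) (Dom B g') \<and> v \<in> hom B (Cod B g) (Cod B g') \<and>
              Comp B g' u = Comp B v g},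
     Dom = (\<lambda>(g, u, v, g'). g), Cod = (\<lambda>(g, u, v, g'). g'),
     Idn = (\<lambda>g. (g, Idn B (Dom B g), Idn B (Cod B g), g)),
     Comp = (\<lambda>(g1, u, v, g2) (g0, u', v', g1'). (g0, Comp B u u', Comp B v v', g2))\<rparr>"

definition cod_fibration ::
  "('o, 'm, 'z) flcat_scheme \<Rightarrow> ('o, 'm, 'm, 'm \<times> 'm \<times> 'm \<times> 'm) cloven" where
  "cod_fibration B = \<lparr>Tot = arrow_cat B,
     Prj = \<lparr>Fo = Cod B, Fm = (\<lambda>(g, u, v, g'). v)\<rparr>,
     Lift = (\<lambda>f X. (Pb2 B X f, Pb1 B X f, f, X))\<rparr>"


section \<open>Internal categories\<close>

text \<open>\<open>iComp\<close> is defined on the chosen pullback of \<open>(iDom, iCod)\<close>, i.e. on pairs \<open>(g, f)\<close> of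
  internal morphisms with \<open>dom g = cod f\<close>.\<close>

record ('o, 'm) icat =
  iObj :: 'o
  iMor :: 'o
  iDom :: 'm
  iCod :: 'm
  iId :: 'm
  iComp :: 'm

text \<open>The composite of two \<open>I\<close>-indexed families \<open>g, f : I \<rightarrow> iMor\<close> with \<open>dom g = cod f\<close>.\<close>

definition icomp ::
  "('o, 'm, 'z) flcat_scheme \<Rightarrow> ('o, 'm, 'y) icat_scheme \<Rightarrow> 'm \<Rightarrow> 'm \<Rightarrow> 'm" where
  "icomp B C g f = Comp B (iComp C) (med B (iDom C) (iCod C) g f)"

text \<open>Associativity is stated on the object of composable triples, the pullback of the second
  along the first projection of the object of composable pairs.\<close>

definition internal_category ::
  "('o, 'm, 'z) flcat_scheme \<Rightarrow> ('o, 'm, 'y) icat_scheme \<Rightarrow> bool" where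
  "internal_category B C \<longleftrightarrow>
     (let p1 = Pb1 B (iDom C) (iCod C); p2 = Pb2 B (iDom C) (iCod C);
          t1 = Pb1 B p2 p1; t2 = Pb2 B p2 p1
      in
        iObj C \<in> Ob B \<and> iMor C \<in> Ob B \<and>
        iDom C \<in> hom B (iMor C) (iObj C) \<and> iCod C \<in> hom B (iMor C) (iObj C) \<and>
        iId C \<in> hom B (iObj C) (iMor C) \<and> iComp C \<in> hom B (Dom B p1) (iMor C) \<and>
        Comp B (iDom C) (iId C) = Idn B (iObj C) \<and>
        Comp B (iCod C) (iId C) = Idn B (iObj C) \<and>
        Comp B (iDom C) (iComp C) = Comp B (iDom C) p2 \<and>
        Comp B (iCod C) (iComp C) = Comp B (iCod C) p1 \<and>
        icomp B C (Comp B (iId C) (iCod C)) (Idn B (iMor C)) = Idn B (iMor C) \<and>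
        icomp B C (Idn B (iMor C)) (Comp B (iId C) (iDom C)) = Idn B (iMor C) \<and>
        icomp B C (Comp B (iComp C) t1) (Comp B p2 t2) =
          icomp B C (Comp B p1 t1) (Comp B (iComp C) t2))"

text \<open>An internal functor is given by its components on objects and on morphisms.\<close>

record 'm ifunc =
  hObj :: 'm
  hMor :: 'm

definition internal_functor ::
  "('o, 'm, 'z) flcat_scheme \<Rightarrow> ('o, 'm, 'y) icat_scheme \<Rightarrow> ('o, 'm, 'w) icat_scheme \<Rightarrow>
   'm ifunc \<Rightarrow> bool" where
  "internal_functor B C D H \<longleftrightarrow>
     (let p1 = Pb1 B (iDom C) (iCod C); p2 = Pb2 B (iDom C) (iCod C)
      in
        hObj H \<in> hom B (iObj C) (iObj D) \<and> hMor H \<in> hom B (iMor C) (iMor D) \<and>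
        Comp B (iDom D) (hMor H) = Comp B (hObj H) (iDom C) \<and>
        Comp B (iCod D) (hMor H) = Comp B (hObj H) (iCod C) \<and>
        Comp B (hMor H) (iId C) = Comp B (iId D) (hObj H) \<and>
        Comp B (hMor H) (iComp C) = icomp B D (Comp B (hMor H) p1) (Comp B (hMor H) p2))"

text \<open>
  Data for internal chosen finite limits:
  \<^item> \<open>iOne\<close> is the chosen terminal object, and \<open>iBang\<close> sends an object \<open>X\<close> to the morphism
    from \<open>X\<close> to it;
  \<^item> \<open>iPb1\<close>, \<open>iPb2\<close> send a cospan \<open>(a, b)\<close>, i.e. a generalized element of the chosen pullback
    of \<open>(iCod, iCod)\<close>, to the projections of its pullback;
  \<^item> \<open>iMed\<close> sends a commuting square \<open>a \<circ> u = b \<circ> v\<close>, i.e. a generalized element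
    \<open>((a, u), (b, v))\<close> of the chosen pullback of \<open>(iComp, iComp)\<close>, to the mediating morphism
    from the domain of \<open>u\<close> and \<open>v\<close> to the pullback of \<open>(a, b)\<close>.
\<close>

record ('o, 'm) flicat = "('o, 'm) icat" +
  iOne :: 'm
  iBang :: 'm
  iPb1 :: 'm
  iPb2 :: 'm
  iMed :: 'm

text \<open>Uniqueness is stated on the object of all morphisms into \<open>iOne\<close>.\<close>

definition internal_chosen_terminal ::
  "('o, 'm, 'z) flcat_scheme \<Rightarrow> ('o, 'm, 'y) flicat_scheme \<Rightarrow> bool" where
  "internal_chosen_terminal B C \<longleftrightarrow>
     (let i = Pb1 B (iCod C) (iOne C)
      in
        iOne C \<in> hom B (One B) (iObj C) \<and> iBang C \<in> hom B (iObj C) (iMor C) \<and>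
        Comp B (iDom C) (iBang C) = Idn B (iObj C) \<and>
        Comp B (iCod C) (iBang C) = Comp B (iOne C) (bang B (iObj C)) \<and>
        Comp B (iBang C) (Comp B (iDom C) i) = i)"

text \<open>Below, \<open>k1, k2\<close> is the generic cospan, \<open>((a, u), (b, v))\<close> the generic commuting square
  and \<open>P1, P2\<close> the chosen pullback of its cospan \<open>(a, b)\<close>. Uniqueness of mediating morphisms is
  stated on the object of pairs of a cospan \<open>w1\<close> and a morphism \<open>w2\<close> into its chosen pullback.\<close>

definition internal_chosen_pullbacks ::
  "('o, 'm, 'z) flcat_scheme \<Rightarrow> ('o, 'm, 'y) flicat_scheme \<Rightarrow> bool" where
  "internal_chosen_pullbacks B C \<longleftrightarrow>
     (let k1 = Pb1 B (iCod C) (iCod C); k2 = Pb2 B (iCod C) (iCod C);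
          p1 = Pb1 B (iDom C) (iCod C); p2 = Pb2 B (iDom C) (iCod C);
          s1 = Pb1 B (iComp C) (iComp C); s2 = Pb2 B (iComp C) (iComp C);
          a = Comp B p1 s1; u = Comp B p2 s1; b = Comp B p1 s2; v = Comp B p2 s2;
          ab = med B (iCod C) (iCod C) a b;
          P1 = Comp B (iPb1 C) ab; P2 = Comp B (iPb2 C) ab;
          apex = Comp B (iDom C) (iPb1 C);
          w1 = Pb1 B apex (iCod C); w2 = Pb2 B apex (iCod C);
          l1 = med B (iDom C) (iCod C) (Comp B k1 w1) (icomp B C (Comp B (iPb1 C) w1) w2);
          l2 = med B (iDom C) (iCod C) (Comp B k2 w1) (icomp B C (Comp B (iPb2 C) w1) w2)
      in
        iPb1 C \<in> hom B (Dom B k1) (iMor C) \<and> iPb2 C \<in> hom B (Dom B k1) (iMor C) \<and>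
        iMed C \<in> hom B (Dom B s1) (iMor C) \<and>
        Comp B (iCod C) (iPb1 C) = Comp B (iDom C) k1 \<and>
        Comp B (iCod C) (iPb2 C) = Comp B (iDom C) k2 \<and>
        Comp B (iDom C) (iPb1 C) = Comp B (iDom C) (iPb2 C) \<and>
        icomp B C k1 (iPb1 C) = icomp B C k2 (iPb2 C) \<and>
        Comp B (iDom C) (iMed C) = Comp B (iDom C) u \<and>
        Comp B (iCod C) (iMed C) = Comp B (iDom C) P1 \<and>
        icomp B C P1 (iMed C) = u \<and>
        icomp B C P2 (iMed C) = v \<and>
        Comp B (iMed C) (med B (iComp C) (iComp C) l1 l2) = w2)"

definition has_internal_chosen_finite_limits ::
  "('o, 'm, 'z) flcat_scheme \<Rightarrow> ('o, 'm, 'y) flicat_scheme \<Rightarrow> bool" where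
  "has_internal_chosen_finite_limits B C \<longleftrightarrow>
     internal_category B C \<and> internal_chosen_terminal B C \<and> internal_chosen_pullbacks B C"

text \<open>The underlying category, with morphisms \<open>X \<rightarrow> Y\<close> the global elements of the object of
  morphisms that have domain \<open>X\<close> and codomain \<open>Y\<close>.\<close>

definition Gamma ::
  "('o, 'm, 'z) flcat_scheme \<Rightarrow> ('o, 'm, 'y) flicat_scheme \<Rightarrow> ('m, 'm) flcat" where
  "Gamma B C = \<lparr>Ob = hom B (One B) (iObj C), Mor = hom B (One B) (iMor C),
     Dom = (\<lambda>f. Comp B (iDom C) f), Cod = (\<lambda>f. Comp B (iCod C) f),
     Idn = (\<lambda>X. Comp B (iId C) X), Comp = icomp B C,
     One = iOne C,
     Pb1 = (\<lambda>f g. Comp B (iPb1 C) (med B (iCod C) (iCod C) f g)),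
     Pb2 = (\<lambda>f g. Comp B (iPb2 C) (med B (iCod C) (iCod C) f g))\<rparr>"

definition Gamma_func :: "('o, 'm, 'z) flcat_scheme \<Rightarrow> 'm ifunc \<Rightarrow> ('m, 'm, 'm, 'm) func" where
  "Gamma_func B H = \<lparr>Fo = (\<lambda>X. Comp B (hObj H) X), Fm = (\<lambda>f. Comp B (hMor H) f)\<rparr>"

definition homincl ::
  "('o, 'm, 'z) flcat_scheme \<Rightarrow> ('o, 'm, 'y) icat_scheme \<Rightarrow> 'm \<Rightarrow> 'm \<Rightarrow> 'm" where
  "homincl B C X Y = Pb1 B (tup B (iDom C) (iCod C)) (tup B X Y)"

definition homobj ::
  "('o, 'm, 'z) flcat_scheme \<Rightarrow> ('o, 'm, 'y) icat_scheme \<Rightarrow> 'm \<Rightarrow> 'm \<Rightarrow> 'o" where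
  "homobj B C X Y = Dom B (homincl B C X Y)"

text \<open>\<open>into_hom B C X Y f\<close> factors a family \<open>f : I \<rightarrow> iMor\<close> of morphisms from \<open>X\<close> to \<open>Y\<close> through
  the hom-object.\<close>

definition into_hom ::
  "('o, 'm, 'z) flcat_scheme \<Rightarrow> ('o, 'm, 'y) icat_scheme \<Rightarrow> 'm \<Rightarrow> 'm \<Rightarrow> 'm \<Rightarrow> 'm" where
  "into_hom B C X Y f =
     med B (tup B (iDom C) (iCod C)) (tup B X Y) f (bang B (Dom B f))"

definition global_section ::
  "('o, 'm, 'z) flcat_scheme \<Rightarrow> ('o, 'm, 'y) flicat_scheme \<Rightarrow> ('m, 'm, 'o, 'm) func" where
  "global_section B C =
     \<lparr>Fo = (\<lambda>X. homobj B C (iOne C) X),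
      Fm = (\<lambda>f. let X = Comp B (iDom C) f; Y = Comp B (iCod C) f; i = homincl B C (iOne C) X
              in into_hom B C (iOne C) Y (icomp B C (Comp B f (bang B (Dom B i))) i))\<rparr>"

text \<open>The image of an internal category under a functor \<open>G : B \<rightarrow> B'\<close> preserving finite limits.
  Since \<open>G\<close> need not preserve the chosen pullbacks strictly, the composition morphism is
  precomposed with the canonical isomorphism from the chosen object of composable pairs in \<open>B'\<close>
  to the image of the one in \<open>B\<close>.\<close>

definition image_icat ::
  "('o, 'm, 'z) flcat_scheme \<Rightarrow> ('p, 'n, 'y) flcat_scheme \<Rightarrow> ('o, 'm, 'p, 'n) func \<Rightarrow>
   ('o, 'm, 'w) icat_scheme \<Rightarrow> ('p, 'n) icat" where
  "image_icat B B' G C =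
     (let p1 = Pb1 B (iDom C) (iCod C); p2 = Pb2 B (iDom C) (iCod C);
          q1 = Pb1 B' (Fm G (iDom C)) (Fm G (iCod C));
          q2 = Pb2 B' (Fm G (iDom C)) (Fm G (iCod C));
          can = (THE m. m \<in> hom B' (Dom B' q1) (Fo G (Dom B p1)) \<and>
                   Comp B' (Fm G p1) m = q1 \<and> Comp B' (Fm G p2) m = q2)
      in \<lparr>iObj = Fo G (iObj C), iMor = Fo G (iMor C), iDom = Fm G (iDom C), iCod = Fm G (iCod C),
          iId = Fm G (iId C), iComp = Comp B' (Fm G (iComp C)) can\<rparr>)"

text \<open>The functor from \<open>Gamma B C\<close> to the underlying category of the image of \<open>C\<close> under \<open>G\<close>,
  applying \<open>G\<close> to global elements and precomposing with the canonical isomorphism between the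
  chosen terminal object of \<open>B'\<close> and the image of the one of \<open>B\<close>.\<close>

definition sharp ::
  "('o, 'm, 'z) flcat_scheme \<Rightarrow> ('p, 'n, 'y) flcat_scheme \<Rightarrow> ('o, 'm, 'p, 'n) func \<Rightarrow>
   ('m, 'm, 'n, 'n) func" where
  "sharp B B' G =
     (let e = (THE m. m \<in> hom B' (One B') (Fo G (One B)))
      in \<lparr>Fo = (\<lambda>X. Comp B' (Fm G X) e), Fm = (\<lambda>f. Comp B' (Fm G f) e)\<rparr>)"

definition func_comp ::
  "('p, 'n, 'q, 'r) func \<Rightarrow> ('o, 'm, 'p, 'n) func \<Rightarrow> ('o, 'm, 'q, 'r) func" where
  "func_comp G F = \<lparr>Fo = (\<lambda>A. Fo G (Fo F A)), Fm = (\<lambda>f. Fm G (Fm F f))\<rparr>"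

definition func_eq_on ::
  "('o, 'm, 'z) cat_scheme \<Rightarrow> ('o, 'm, 'p, 'n) func \<Rightarrow> ('o, 'm, 'p, 'n) func \<Rightarrow> bool" where
  "func_eq_on C F G \<longleftrightarrow> (\<forall>A\<in>Ob C. Fo F A = Fo G A) \<and> (\<forall>f\<in>Mor C. Fm F f = Fm G f)"


section \<open>Pre-geminal categories\<close>

definition box ::
  "('o, 'm, 'z) flcat_scheme \<Rightarrow> ('o, 'm, 'y) flicat_scheme \<Rightarrow> ('o, 'm, 'm, 'm) func \<Rightarrow>
   ('o, 'm, 'o, 'm) func" where
  "box B C F = func_comp (global_section B C) F"

text \<open>A global object (or morphism) of the image of \<open>C\<close> under \<open>F\<close> is a morphism of \<open>Gamma B C\<close>
  from \<open>iOne C\<close> to some \<open>Y\<close>, that is, a global element of \<open>iMor C\<close> with these as domain and codomain.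
  The canonical isomorphism to the underlying category of the image of \<open>C\<close> under \<open>box\<close> sends it to the
  corresponding global element of the hom-object \<open>homobj B C (iOne C) Y\<close>.\<close>

definition canonical_iso ::
  "('o, 'm, 'z) flcat_scheme \<Rightarrow> ('o, 'm, 'y) flicat_scheme \<Rightarrow> ('m, 'm, 'm, 'm) func" where
  "canonical_iso B C =
     (let n = (\<lambda>x. into_hom B C (iOne C) (Comp B (iCod C) x) x) in \<lparr>Fo = n, Fm = n\<rparr>)"

definition pre_geminal ::
  "('o, 'm) flcat \<Rightarrow> ('o, 'm) flicat \<Rightarrow> ('o, 'm, 'm, 'm) func \<Rightarrow> 'm ifunc \<Rightarrow> bool" where
  "pre_geminal B C F H \<longleftrightarrow>
     has_chosen_finite_limits B \<and>
     has_internal_chosen_finite_limits B C \<and>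
     is_functor B (Gamma B C) F \<and> strictly_preserves_finite_limits B (Gamma B C) F \<and>
     internal_functor B C (image_icat B B (box B C F) C) H \<and>
     func_eq_on B
       (func_comp (Gamma_func B H) F)
       (func_comp (canonical_iso B C) (func_comp (sharp B (Gamma B C) F) F))"


section \<open>The induced code data\<close>

text \<open>
  That a pre-geminal category merely admits \<^emph>\<open>some\<close> code structure carries no information: on any
  cloven fibration one obtains one by taking every object of codes to be terminal. The data induced
  by \<open>(B, C, F, H)\<close> are the following.
  \<^item> Morphisms \<open>A \<rightarrow> A'\<close> are coded in the internal hom-object from \<open>F A\<close> to \<open>F A'\<close>. An object of
    the fiber over \<open>A\<close> is a morphism, either from \<open>A\<close> to \<open>D\<close> or from any object to \<open>A\<close>; it is
    coded in the hom-object from \<open>F A\<close> to \<open>F D\<close>, respectively in the object of all internal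
    morphisms with codomain \<open>F A\<close>. In each case the code of \<open>f\<close> is \<open>F f\<close>.
  \<^item> \<open>App\<close> is composition in \<open>C\<close>, respectively pullback in \<open>C\<close>.
  \<^item> \<open>Code\<close> is the morphism part of \<open>H\<close>, restricted to the given object of codes. Its codomain is
    a hom-object from \<open>F (One B)\<close>, and \<open>F (One B)\<close> is \<open>iOne C\<close>, so it is a value of \<open>box B C F\<close>.
\<close>

definition restrict_H ::
  "('o, 'm) flcat \<Rightarrow> ('o, 'm) flicat \<Rightarrow> ('o, 'm, 'm, 'm) func \<Rightarrow> 'm ifunc \<Rightarrow> 'm \<Rightarrow> 'm" where
  "restrict_H B C F H i =
     (THE m. m \<in> hom B (Dom B i) (Fo (box B C F) (Dom B i)) \<and>
        Comp B (Fm (box B C F) i) m = Comp B (hMor H) i)"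

definition hom_code ::
  "('o, 'm) flcat \<Rightarrow> ('o, 'm) flicat \<Rightarrow> ('o, 'm, 'm, 'm) func \<Rightarrow> 'o \<Rightarrow> 'o \<Rightarrow> 'm \<Rightarrow> 'm" where
  "hom_code B C F A A' f = into_hom B C (Fo F A) (Fo F A') (Fm F f)"

definition dom_codes ::
  "('o, 'm) flcat \<Rightarrow> ('o, 'm) flicat \<Rightarrow> ('o, 'm, 'm, 'm) func \<Rightarrow> 'm ifunc \<Rightarrow> 'o \<Rightarrow>
   ('o, 'm, 'm) codes" where
  "dom_codes B C F H D =
     (let hin = (\<lambda>A A'. homincl B C (Fo F A) (Fo F A'));
          hob = (\<lambda>A A'. homobj B C (Fo F A) (Fo F A'))
      in \<lparr>EO = (\<lambda>A. hob A D),
          EC = (\<lambda>A X. hom_code B C F A D X),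
          HO = hob,
          HC = hom_code B C F,
          App = (\<lambda>A A'. into_hom B C (Fo F A) (Fo F D)
                  (icomp B C (Comp B (hin A' D) (Pr1 B (hob A' D) (hob A A')))
                             (Comp B (hin A A') (Pr2 B (hob A' D) (hob A A'))))),
          Code = (\<lambda>A. restrict_H B C F H (hin A D))\<rparr>)"

definition cod_codes ::
  "('o, 'm) flcat \<Rightarrow> ('o, 'm) flicat \<Rightarrow> ('o, 'm, 'm, 'm) func \<Rightarrow> 'm ifunc \<Rightarrow>
   ('o, 'm, 'm) codes" where
  "cod_codes B C F H =
     (let hin = (\<lambda>A A'. homincl B C (Fo F A) (Fo F A'));
          hob = (\<lambda>A A'. homobj B C (Fo F A) (Fo F A'));
          sin = (\<lambda>A. Pb1 B (iCod C) (Fo F A));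
          sob = (\<lambda>A. Dom B (sin A));
          into = (\<lambda>A f. med B (iCod C) (Fo F A) f (bang B (Dom B f)))
      in \<lparr>EO = sob,
          EC = (\<lambda>A X. into A (Fm F X)),
          HO = hob,
          HC = hom_code B C F,
          App = (\<lambda>A A'. into A (Comp B (iPb2 C) (med B (iCod C) (iCod C)
                  (Comp B (sin A') (Pr1 B (sob A') (hob A A')))
                  (Comp B (hin A A') (Pr2 B (sob A') (hob A A')))))),
          Code = (\<lambda>A. restrict_H B C F H (sin A))\<rparr>)"

end

theory Submission
  imports Defs
begin

text \<open>
  The equivalences \<open>\<approx>\<close> required of a code structure all hold as equalities, so it suffices that
  reindexing functors exist. For \<open>App\<close> the equalities say that \<open>F\<close> preserves composition,
  respectively chosen pullbacks. For \<open>Code\<close>, a morphism from \<open>I\<close> to \<open>\<box>A\<close> is an \<open>I\<close>-indexed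
  family of internal morphisms from the terminal object to \<open>F A\<close>; since \<open>F\<close> preserves chosen
  pullbacks and those of \<open>C\<close> have the universal property for families, \<open>\<box>\<close> preserves pullbacks. An
  object of codes is a pullback along a global object \<open>F A\<close> (or a pair of them), so \<open>\<box>\<close> of it is
  the pullback along \<open>\<box> (F A)\<close>. The equation \<open>\<Gamma> H \<circ> F = F\<^sup># \<circ> F\<close> says that \<open>H\<close> sends the
  element \<open>F x\<close> to the element of \<open>\<box>\<close> named by \<open>F (F x)\<close>: on objects this lets \<open>H\<close> factor
  through that pullback, and on morphisms it identifies \<open>Code \<circ> \<lceil>X\<rceil>\<close> with the code of \<open>\<lceil>X\<rceil>\<close>.
\<close>

section \<open>Categories with chosen finite limits\<close>

lemma in_hom_iff: "f \<in> hom C X Y \<longleftrightarrow> f \<in> Mor C \<and> Dom C f = X \<and> Cod C f = Y"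
  by (auto simp: hom_def)

locale cat =
  fixes B :: "('o, 'm, 'z) cat_scheme" (structure)
  assumes is_category: "category B"
begin

abbreviation comp (infixr "\<cdot>" 70) where "g \<cdot> f \<equiv> Comp B g f"

lemma Dom_Cod_in [simp]:
  assumes "f \<in> Mor B" shows "Dom B f \<in> Ob B" "Cod B f \<in> Ob B"
  using is_category assms by (auto simp: category_def)

lemma Idn_simps [simp]:
  assumes "A \<in> Ob B" shows "Idn B A \<in> Mor B" "Dom B (Idn B A) = A" "Cod B (Idn B A) = A"
  using is_category assms by (auto simp: category_def hom_def)

lemma Comp_simps [simp]:
  assumes "f \<in> Mor B" "g \<in> Mor B" "Cod B f = Dom B g"
  shows "g \<cdot> f \<in> Mor B" "Dom B (g \<cdot> f) = Dom B f" "Cod B (g \<cdot> f) = Cod B g"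
  using is_category assms by (auto simp: category_def hom_def)

lemma Comp_Idn_left [simp]: "f \<in> Mor B \<Longrightarrow> Cod B f = A \<Longrightarrow> Idn B A \<cdot> f = f"
  using is_category by (auto simp: category_def)

lemma Comp_Idn_right [simp]: "f \<in> Mor B \<Longrightarrow> Dom B f = A \<Longrightarrow> f \<cdot> Idn B A = f"
  using is_category by (auto simp: category_def)

lemma Comp_assoc [simp]:
  assumes "f \<in> Mor B" "g \<in> Mor B" "h \<in> Mor B" "Cod B f = Dom B g" "Cod B g = Dom B h"
  shows "(h \<cdot> g) \<cdot> f = h \<cdot> g \<cdot> f"
  using is_category assms by (simp add: category_def)

end

locale finite_limit_category =
  fixes B :: "('o, 'm, 'z) flcat_scheme" (structure)
  assumes has_limits: "has_chosen_finite_limits B"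

sublocale finite_limit_category \<subseteq> cat B
  using has_limits by unfold_locales (simp add: has_chosen_finite_limits_def)

context finite_limit_category
begin

lemma terminal_One: "terminal B (One B)"
  using has_limits by (simp add: has_chosen_finite_limits_def)

lemma One_in [simp]: "One B \<in> Ob B"
  using terminal_One by (simp add: terminal_def)

lemma bang_simps [simp]:
  assumes "A \<in> Ob B"
  shows "bang B A \<in> Mor B" "Dom B (bang B A) = A" "Cod B (bang B A) = One B"
proof -
  have "\<exists>!m. m \<in> hom B A (One B)"
    using terminal_One assms by (simp add: terminal_def)
  then have "bang B A \<in> hom B A (One B)"
    unfolding bang_def by (rule theI')
  then show "bang B A \<in> Mor B" "Dom B (bang B A) = A" "Cod B (bang B A) = One B"
    by (auto simp: hom_def)
qed

lemma to_One_unique: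
  assumes "f \<in> Mor B" "g \<in> Mor B" "Dom B f = Dom B g" "Cod B f = One B" "Cod B g = One B"
  shows "f = g"
proof -
  have "\<exists>!m. m \<in> hom B (Dom B g) (One B)"
    using terminal_One assms by (simp add: terminal_def)
  with assms show ?thesis by (auto simp: hom_def)
qed

lemma eq_bang: "f \<in> Mor B \<Longrightarrow> Cod B f = One B \<Longrightarrow> f = bang B (Dom B f)"
  by (rule to_One_unique) simp_all

text \<open>With \<open>bang_One\<close> this brings composites through a \<open>bang\<close> into
  one normal form, so that constant families \<open>X \<cdot> bang B I\<close> are recognized after
  reindexing.\<close>

lemma bang_Comp [simp]: "f \<in> Mor B \<Longrightarrow> Cod B f = A \<Longrightarrow> bang B A \<cdot> f = bang B (Dom B f)"
  by (rule to_One_unique) auto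

lemma bang_One [simp]: "bang B (One B) = Idn B (One B)"
  by (rule to_One_unique) simp_all

section \<open>Chosen pullbacks and their mediating morphisms\<close>

lemma pullback_Pb:
  "f \<in> Mor B \<Longrightarrow> g \<in> Mor B \<Longrightarrow> Cod B f = Cod B g \<Longrightarrow> is_pullback B f g (Pb1 B f g) (Pb2 B f g)"
  using has_limits by (simp add: has_chosen_finite_limits_def)

lemma Pb_simps [simp]:
  assumes "f \<in> Mor B" "g \<in> Mor B" "Cod B f = Cod B g"
  shows "Pb1 B f g \<in> Mor B" "Cod B (Pb1 B f g) = Dom B f"
    "Pb2 B f g \<in> Mor B" "Cod B (Pb2 B f g) = Dom B g"
    "Dom B (Pb2 B f g) = Dom B (Pb1 B f g)"
  using pullback_Pb[OF assms] by (auto simp: is_pullback_def hom_def)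

lemma Pb_comm:
  "f \<in> Mor B \<Longrightarrow> g \<in> Mor B \<Longrightarrow> Cod B f = Cod B g \<Longrightarrow> f \<cdot> Pb1 B f g = g \<cdot> Pb2 B f g"
  using pullback_Pb[of f g] by (auto simp: is_pullback_def)

text \<open>The universal property justifies the definite description in \<open>med\<close>. The
  domain is given as \<open>Dom B k\<close> because the premise \<open>Dom B h = Dom B k\<close>
  rewrites in that direction.\<close>

lemma med_simps [simp]:
  assumes "f \<in> Mor B" "g \<in> Mor B" "Cod B f = Cod B g" "h \<in> Mor B" "k \<in> Mor B"
    "Dom B h = Dom B k" "Cod B h = Dom B f" "Cod B k = Dom B g" "f \<cdot> h = g \<cdot> k"
  shows "med B f g h k \<in> Mor B" "Dom B (med B f g h k) = Dom B k"
    "Cod B (med B f g h k) = Dom B (Pb1 B f g)"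
    "Pb1 B f g \<cdot> med B f g h k = h" "Pb2 B f g \<cdot> med B f g h k = k"
proof -
  have "\<exists>!m. m \<in> hom B (Dom B h) (Dom B (Pb1 B f g)) \<and> Pb1 B f g \<cdot> m = h \<and> Pb2 B f g \<cdot> m = k"
    using pullback_Pb[OF assms(1-3)] assms
    by (auto simp: is_pullback_def in_hom_iff)
  then have "med B f g h k \<in> hom B (Dom B h) (Dom B (Pb1 B f g)) \<and>
      Pb1 B f g \<cdot> med B f g h k = h \<and> Pb2 B f g \<cdot> med B f g h k = k"
    unfolding med_def by (rule theI')
  then show "med B f g h k \<in> Mor B" "Dom B (med B f g h k) = Dom B k"
    "Cod B (med B f g h k) = Dom B (Pb1 B f g)"
    "Pb1 B f g \<cdot> med B f g h k = h" "Pb2 B f g \<cdot> med B f g h k = k"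
    using assms by (auto simp: hom_def)
qed

text \<open>Both morphisms mediate the cone obtained from \<open>x\<close>, so the uniqueness clause
  applies. Equality of their domains is read off from the equation on first projections.\<close>

lemma Pb_joint_mono:
  assumes "f \<in> Mor B" "g \<in> Mor B" "Cod B f = Cod B g" "x \<in> Mor B" "y \<in> Mor B"
    "Cod B x = Dom B (Pb1 B f g)" "Cod B y = Dom B (Pb1 B f g)"
    "Pb1 B f g \<cdot> x = Pb1 B f g \<cdot> y" "Pb2 B f g \<cdot> x = Pb2 B f g \<cdot> y"
  shows "x = y"
proof -
  have "Dom B x = Dom B (Pb1 B f g \<cdot> x)" using assms(1-6) by simp
  also have "\<dots> = Dom B y" using assms by simp
  finally have d: "Dom B x = Dom B y" .
  have "f \<cdot> Pb1 B f g \<cdot> x = (f \<cdot> Pb1 B f g) \<cdot> x"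
    using assms(1-6) by simp
  also have "\<dots> = g \<cdot> Pb2 B f g \<cdot> x"
    using assms(1-6) by (simp add: Pb_comm del: Comp_assoc) simp
  finally have "\<exists>!m. m \<in> hom B (Dom B x) (Dom B (Pb1 B f g)) \<and>
      Pb1 B f g \<cdot> m = Pb1 B f g \<cdot> x \<and> Pb2 B f g \<cdot> m = Pb2 B f g \<cdot> x"
    using pullback_Pb[OF assms(1-3)] assms(1-6) by (simp add: is_pullback_def in_hom_iff)
  with assms d show ?thesis by (auto simp: in_hom_iff)
qed

text \<open>\<open>Comp_assoc\<close> nests composites to the right, which hides
  \<open>Pb1 B f g \<cdot> med B f g h k\<close> as soon as another factor follows; these versions
  carry that factor.\<close>

lemma Pb1_med_Comp [simp]:
  assumes "f \<in> Mor B" "g \<in> Mor B" "Cod B f = Cod B g" "h \<in> Mor B" "k \<in> Mor B"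
    "Dom B h = Dom B k" "Cod B h = Dom B f" "Cod B k = Dom B g" "f \<cdot> h = g \<cdot> k"
    "x \<in> Mor B" "Cod B x = Dom B k"
  shows "Pb1 B f g \<cdot> med B f g h k \<cdot> x = h \<cdot> x" "Pb2 B f g \<cdot> med B f g h k \<cdot> x = k \<cdot> x"
  using assms Comp_assoc[of x "med B f g h k" "Pb1 B f g"] Comp_assoc[of x "med B f g h k" "Pb2 B f g"]
  by (simp_all del: Comp_assoc)

text \<open>Under nesting to the right, an equation between two composites does not rewrite inside a
  longer one; this rule extends it by a trailing factor.\<close>

lemma Comp_cong_assoc:
  assumes "f \<cdot> h = g \<cdot> k" "f \<in> Mor B" "g \<in> Mor B" "h \<in> Mor B" "k \<in> Mor B" "x \<in> Mor B"
    "Cod B h = Dom B f" "Cod B k = Dom B g" "Cod B x = Dom B h" "Dom B h = Dom B k"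
  shows "f \<cdot> h \<cdot> x = g \<cdot> k \<cdot> x"
  using assms Comp_assoc[of x h f] Comp_assoc[of x k g] by (simp del: Comp_assoc)

text \<open>Mediating morphisms are natural in their source. This is what later transfers statements
  about generic elements to families.\<close>

lemma med_Comp:
  assumes "f \<in> Mor B" "g \<in> Mor B" "Cod B f = Cod B g" "h \<in> Mor B" "k \<in> Mor B"
    "Dom B h = Dom B k" "Cod B h = Dom B f" "Cod B k = Dom B g" "f \<cdot> h = g \<cdot> k"
    "x \<in> Mor B" "Cod B x = Dom B k"
  shows "med B f g h k \<cdot> x = med B f g (h \<cdot> x) (k \<cdot> x)"
proof -
  have e: "f \<cdot> h \<cdot> x = g \<cdot> k \<cdot> x" by (rule Comp_cong_assoc) (use assms in auto)
  show ?thesis by (rule Pb_joint_mono[of f g]) (use assms e in simp_all)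
qed

section \<open>Binary products as pullbacks over the terminal object\<close>

lemma Pr_simps [simp]:
  assumes "X \<in> Ob B" "Y \<in> Ob B"
  shows "Pr1 B X Y \<in> Mor B" "Cod B (Pr1 B X Y) = X" "Pr2 B X Y \<in> Mor B" "Cod B (Pr2 B X Y) = Y"
    "Dom B (Pr2 B X Y) = Dom B (Pr1 B X Y)"
  using assms by (simp_all add: Pr1_def Pr2_def)

lemma Pr_joint_mono:
  assumes "X \<in> Ob B" "Y \<in> Ob B" "x \<in> Mor B" "y \<in> Mor B"
    "Cod B x = Dom B (Pr1 B X Y)" "Cod B y = Dom B (Pr1 B X Y)"
    "Pr1 B X Y \<cdot> x = Pr1 B X Y \<cdot> y" "Pr2 B X Y \<cdot> x = Pr2 B X Y \<cdot> y"
  shows "x = y"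
  by (rule Pb_joint_mono[of "bang B X" "bang B Y"])
    (use assms in \<open>simp_all add: Pr1_def Pr2_def\<close>)

lemma is_product_Pr:
  assumes "X \<in> Ob B" "Y \<in> Ob B"
  shows "is_product B X Y (Pr1 B X Y) (Pr2 B X Y)"
  unfolding is_product_def
proof (intro conjI ballI)
  fix I f g assume I: "I \<in> Ob B" and fg: "f \<in> hom B I X" "g \<in> hom B I Y"
  show "\<exists>!m. m \<in> hom B I (Dom B (Pr1 B X Y)) \<and> Pr1 B X Y \<cdot> m = f \<and> Pr2 B X Y \<cdot> m = g"
  proof (rule ex1I[of _ "med B (bang B X) (bang B Y) f g"])
    fix m assume m: "m \<in> hom B I (Dom B (Pr1 B X Y)) \<and> Pr1 B X Y \<cdot> m = f \<and> Pr2 B X Y \<cdot> m = g"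
    show "m = med B (bang B X) (bang B Y) f g"
      by (rule Pr_joint_mono[of X Y]) (use m fg I assms in \<open>auto simp: in_hom_iff Pr1_def Pr2_def\<close>)
  qed (use fg I assms in \<open>auto simp: Pr1_def Pr2_def in_hom_iff\<close>)
qed (use assms in \<open>auto simp: in_hom_iff\<close>)

lemma has_products_Pr: "has_products B (Pr1 B) (Pr2 B)"
  by (simp add: has_products_def is_product_Pr)

lemma tup_simps [simp]:
  assumes "f \<in> Mor B" "g \<in> Mor B" "Dom B f = Dom B g"
  shows "tup B f g \<in> Mor B" "Dom B (tup B f g) = Dom B g"
    "Cod B (tup B f g) = Dom B (Pr1 B (Cod B f) (Cod B g))"
    "Pr1 B (Cod B f) (Cod B g) \<cdot> tup B f g = f" "Pr2 B (Cod B f) (Cod B g) \<cdot> tup B f g = g"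
proof -
  have "\<exists>!m. m \<in> hom B (Dom B f) (Dom B (Pr1 B (Cod B f) (Cod B g))) \<and>
      Pr1 B (Cod B f) (Cod B g) \<cdot> m = f \<and> Pr2 B (Cod B f) (Cod B g) \<cdot> m = g"
    using is_product_Pr[of "Cod B f" "Cod B g"] assms by (auto simp: is_product_def in_hom_iff)
  from theI'[OF this]
  have "tup B f g \<in> hom B (Dom B f) (Dom B (Pr1 B (Cod B f) (Cod B g))) \<and>
      Pr1 B (Cod B f) (Cod B g) \<cdot> tup B f g = f \<and> Pr2 B (Cod B f) (Cod B g) \<cdot> tup B f g = g"
    unfolding tup_def pairing_def Let_def .
  then show "tup B f g \<in> Mor B" "Dom B (tup B f g) = Dom B g"
    "Cod B (tup B f g) = Dom B (Pr1 B (Cod B f) (Cod B g))"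
    "Pr1 B (Cod B f) (Cod B g) \<cdot> tup B f g = f" "Pr2 B (Cod B f) (Cod B g) \<cdot> tup B f g = g"
    using assms by (auto simp: in_hom_iff)
qed

lemma Pr_tup_Comp:
  assumes "f \<in> Mor B" "g \<in> Mor B" "Dom B f = Dom B g" "x \<in> Mor B" "Cod B x = Dom B g"
    "Cod B f = X" "Cod B g = Y"
  shows "Pr1 B X Y \<cdot> tup B f g \<cdot> x = f \<cdot> x" "Pr2 B X Y \<cdot> tup B f g \<cdot> x = g \<cdot> x"
  using assms Comp_assoc[of x "tup B f g" "Pr1 B X Y"] Comp_assoc[of x "tup B f g" "Pr2 B X Y"]
  by (auto simp del: Comp_assoc)

text \<open>A square over a product splits over the two factors. Two different pairs are allowed so
  that \<open>tup B (iDom C) (iCod C)\<close> can be compared with \<open>tup B X Y\<close>, as in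
  the definition of hom-objects.\<close>

lemma tup_Comp_eq_iff:
  assumes "f \<in> Mor B" "g \<in> Mor B" "Dom B f = Dom B g" "x \<in> Mor B" "Cod B x = Dom B g"
    "f' \<in> Mor B" "g' \<in> Mor B" "Dom B f' = Dom B g'" "x' \<in> Mor B" "Cod B x' = Dom B g'"
    "Cod B f = Cod B f'" "Cod B g = Cod B g'"
  shows "tup B f g \<cdot> x = tup B f' g' \<cdot> x' \<longleftrightarrow> f \<cdot> x = f' \<cdot> x' \<and> g \<cdot> x = g' \<cdot> x'"
proof
  assume "tup B f g \<cdot> x = tup B f' g' \<cdot> x'"
  then show "f \<cdot> x = f' \<cdot> x' \<and> g \<cdot> x = g' \<cdot> x'"
    using assms Pr_tup_Comp[of f g x "Cod B f" "Cod B g"] Pr_tup_Comp[of f' g' x' "Cod B f" "Cod B g"] by simp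
next
  assume e: "f \<cdot> x = f' \<cdot> x' \<and> g \<cdot> x = g' \<cdot> x'"
  show "tup B f g \<cdot> x = tup B f' g' \<cdot> x'"
    by (rule Pr_joint_mono[of "Cod B f" "Cod B g"]) (use assms e in \<open>auto simp: Pr_tup_Comp\<close>)
qed

end

section \<open>Cloven fibrations\<close>

lemma cartesian_factor:
  assumes "cartesian B p \<phi>" "\<psi> \<in> Mor (Tot p)" "Cod (Tot p) \<psi> = Cod (Tot p) \<phi>"
    "h \<in> hom B (Fo (Prj p) (Dom (Tot p) \<psi>)) (Fo (Prj p) (Dom (Tot p) \<phi>))"
    "Comp B (Fm (Prj p) \<phi>) h = Fm (Prj p) \<psi>"
  shows "\<exists>!\<chi>. \<chi> \<in> hom (Tot p) (Dom (Tot p) \<psi>) (Dom (Tot p) \<phi>) \<and> Fm (Prj p) \<chi> = h \<and> Comp (Tot p) \<phi> \<chi> = \<psi>"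
  using assms by (auto simp: cartesian_def)

text \<open>Morphisms of the fiber are only asked to lie over \<open>Idn B A\<close>; functoriality
  of the projection then forces both of their ends to lie over \<open>A\<close>.\<close>

lemma category_fiber:
  assumes "cloven_fibration B p" "A \<in> Ob B"
  shows "category (fiber B p A)"
proof -
  interpret B: cat B using assms by unfold_locales (simp add: cloven_fibration_def)
  interpret E: cat "Tot p" using assms by unfold_locales (simp add: cloven_fibration_def)
  have F: "is_functor (Tot p) B (Prj p)" using assms by (simp add: cloven_fibration_def)
  have D: "Fo (Prj p) (Dom (Tot p) v) = A" "Fo (Prj p) (Cod (Tot p) v) = A"
    if "v \<in> Mor (Tot p)" "Fm (Prj p) v = Idn B A" for v
  proof -
    have "Fm (Prj p) v \<in> hom B (Fo (Prj p) (Dom (Tot p) v)) (Fo (Prj p) (Cod (Tot p) v))"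
      using F that(1) unfolding is_functor_def by blast
    with that assms show "Fo (Prj p) (Dom (Tot p) v) = A" "Fo (Prj p) (Cod (Tot p) v) = A"
      by (auto simp: in_hom_iff)
  qed
  show ?thesis
    using F assms(2) by (auto simp: category_def fiber_def in_hom_iff D is_functor_def)
qed

text \<open>The definite description in \<open>reindex\<close> denotes because the lifts are
  cartesian. Uniqueness then gives both functor laws: the identity and the composite of the chosen
  vertical morphisms satisfy the characterizing equations.\<close>

lemma is_functor_reindex:
  assumes "cloven_fibration B p" "f \<in> hom B A P"
  shows "is_functor (fiber B p P) (fiber B p A) (reindex B p f)"
proof -
  interpret B: cat B using assms by unfold_locales (simp add: cloven_fibration_def)
  interpret E: cat "Tot p" using assms by unfold_locales (simp add: cloven_fibration_def)
  have F: "is_functor (Tot p) B (Prj p)" using assms by (simp add: cloven_fibration_def)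
  have f: "f \<in> Mor B" "Dom B f = A" "Cod B f = P" using assms by (auto simp: in_hom_iff)
  have FD: "Fo (Prj p) (Dom (Tot p) v) = Dom B (Fm (Prj p) v)"
     "Fo (Prj p) (Cod (Tot p) v) = Cod B (Fm (Prj p) v)" "Fm (Prj p) v \<in> Mor B"
    if "v \<in> Mor (Tot p)" for v
    using F that by (auto simp: is_functor_def in_hom_iff)
  have FC: "Fm (Prj p) (Comp (Tot p) g v) = Comp B (Fm (Prj p) g) (Fm (Prj p) v)"
    if "v \<in> Mor (Tot p)" "g \<in> Mor (Tot p)" "Cod (Tot p) v = Dom (Tot p) g" for g v
    using F that by (auto simp: is_functor_def)
  have FI: "Fm (Prj p) (Idn (Tot p) X) = Idn B (Fo (Prj p) X)" if "X \<in> Ob (Tot p)" for X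
    using F that by (auto simp: is_functor_def)
  define L where "L = Lift p f"
  have L: "cartesian B p (L X)" "L X \<in> Mor (Tot p)" "Cod (Tot p) (L X) = X" "Fm (Prj p) (L X) = f"
    if "X \<in> Ob (Tot p)" "Fo (Prj p) X = P" for X
    using assms that f by (auto simp: cloven_fibration_def L_def cartesian_def)
  have ex: "\<exists>!\<chi>. \<chi> \<in> hom (Tot p) (Dom (Tot p) (L X)) (Dom (Tot p) (L Y)) \<and>
      Fm (Prj p) \<chi> = Idn B A \<and> Comp (Tot p) (L Y) \<chi> = Comp (Tot p) v (L X)"
    if v: "v \<in> Mor (Tot p)" "Fm (Prj p) v = Idn B P" "Dom (Tot p) v = X" "Cod (Tot p) v = Y" for X Y v
  proof -
    have X: "X \<in> Ob (Tot p)" "Fo (Prj p) X = P" and Y: "Y \<in> Ob (Tot p)" "Fo (Prj p) Y = P"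
      using FD[OF v(1)] v f by auto
    \<comment> \<open>The morphism to be factored lies over \<open>Idn B P\<close> composed with
      \<open>f\<close>, that is over \<open>f\<close>, so its factor through \<open>L Y\<close> may
      be asked to lie over \<open>Idn B A\<close>.\<close>
    show ?thesis
      using cartesian_factor[OF L(1)[OF Y], of "Comp (Tot p) v (L X)" "Idn B A"]
        v f L[OF X] L[OF Y] B.Dom_Cod_in[OF f(1)]
      by (simp add: in_hom_iff FD FC)
  qed
  define R where "R = Fm (reindex B p f)"
  have Rex: "\<exists>!\<chi>. \<chi> \<in> hom (Tot p) (Dom (Tot p) (L (Dom (Tot p) v))) (Dom (Tot p) (L (Cod (Tot p) v))) \<and>
      Fm (Prj p) \<chi> = Idn B A \<and> Comp (Tot p) (L (Cod (Tot p) v)) \<chi> = Comp (Tot p) v (L (Dom (Tot p) v))"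
    if v: "v \<in> Mor (Tot p)" "Fm (Prj p) v = Idn B P" for v
    using ex[OF v] by simp
  have R: "R v \<in> hom (Tot p) (Dom (Tot p) (L (Dom (Tot p) v))) (Dom (Tot p) (L (Cod (Tot p) v))) \<and>
      Fm (Prj p) (R v) = Idn B A \<and>
      Comp (Tot p) (L (Cod (Tot p) v)) (R v) = Comp (Tot p) v (L (Dom (Tot p) v))"
    if v: "v \<in> Mor (Tot p)" "Fm (Prj p) v = Idn B P" for v
    using theI'[OF Rex[OF v]] by (simp add: R_def reindex_def L_def Let_def f)
  have R': "R v = \<chi>"
    if v: "v \<in> Mor (Tot p)" "Fm (Prj p) v = Idn B P"
    and "\<chi> \<in> hom (Tot p) (Dom (Tot p) (L (Dom (Tot p) v))) (Dom (Tot p) (L (Cod (Tot p) v))) \<and>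
      Fm (Prj p) \<chi> = Idn B A \<and> Comp (Tot p) (L (Cod (Tot p) v)) \<chi> = Comp (Tot p) v (L (Dom (Tot p) v))" for v \<chi>
    using Rex[OF v] R[OF v] that(3) by blast
  have P: "P \<in> Ob B" "A \<in> Ob B" using f by auto
  have vert: "Fo (Prj p) (Dom (Tot p) v) = P" "Fo (Prj p) (Cod (Tot p) v) = P"
    if "v \<in> Mor (Tot p)" "Fm (Prj p) v = Idn B P" for v
    using FD[OF that(1)] that P by auto
  have Fo: "Fo (reindex B p f) X = Dom (Tot p) (L X)" for X
    by (simp add: reindex_def L_def)
  show ?thesis
    unfolding is_functor_def Fo R_def[symmetric]
  proof (intro conjI ballI impI)
    fix X assume "X \<in> Ob (fiber B p P)"
    then have X: "X \<in> Ob (Tot p)" "Fo (Prj p) X = P" by (auto simp: fiber_def)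
    then show "Dom (Tot p) (L X) \<in> Ob (fiber B p A)"
      using L[OF X] f by (auto simp: fiber_def FD)
    show "R (Idn (fiber B p P) X) = Idn (fiber B p A) (Dom (Tot p) (L X))"
      unfolding fiber_def cat.simps
      by (rule R') (use X L[OF X] f B.Dom_Cod_in[OF f(1)] in \<open>auto simp: FI FD in_hom_iff\<close>)
  next
    fix v assume "v \<in> Mor (fiber B p P)"
    then show "R v \<in> hom (fiber B p A) (Dom (Tot p) (L (Dom (fiber B p P) v))) (Dom (Tot p) (L (Cod (fiber B p P) v)))"
      using R[of v] by (auto simp: fiber_def in_hom_iff)
  next
    fix v w assume "v \<in> Mor (fiber B p P)" "w \<in> Mor (fiber B p P)" "Cod (fiber B p P) v = Dom (fiber B p P) w"
    then have v: "v \<in> Mor (Tot p)" "Fm (Prj p) v = Idn B P" and w: "w \<in> Mor (Tot p)" "Fm (Prj p) w = Idn B P"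
      and vw: "Cod (Tot p) v = Dom (Tot p) w" by (auto simp: fiber_def)
    note Rv = R[OF v, unfolded in_hom_iff] and Rw = R[OF w, unfolded in_hom_iff]
    have LL: "L (Dom (Tot p) v) \<in> Mor (Tot p)" "Cod (Tot p) (L (Dom (Tot p) v)) = Dom (Tot p) v"
      "L (Cod (Tot p) w) \<in> Mor (Tot p)" "Cod (Tot p) (L (Cod (Tot p) w)) = Cod (Tot p) w"
      "L (Dom (Tot p) w) \<in> Mor (Tot p)" "Cod (Tot p) (L (Dom (Tot p) w)) = Dom (Tot p) w"
      using L vert[OF v] vert[OF w] v w by auto
    have "Comp (Tot p) (L (Cod (Tot p) w)) (Comp (Tot p) (R w) (R v)) =
        Comp (Tot p) (Comp (Tot p) (L (Cod (Tot p) w)) (R w)) (R v)"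
      using Rv Rw vw LL by (subst E.Comp_assoc) auto
    also have "\<dots> = Comp (Tot p) w (Comp (Tot p) (L (Dom (Tot p) w)) (R v))"
      using Rv Rw vw LL w by simp
    also have "\<dots> = Comp (Tot p) (Comp (Tot p) w v) (L (Dom (Tot p) v))"
      using Rv Rw vw LL v w by simp
    finally have e: "Comp (Tot p) (L (Cod (Tot p) w)) (Comp (Tot p) (R w) (R v)) = \<dots>" .
    have "R (Comp (Tot p) w v) = Comp (Tot p) (R w) (R v)"
      by (rule R') (use v w vw Rv Rw P e in \<open>auto simp: FC in_hom_iff\<close>)
    then show "R (Comp (fiber B p P) w v) = Comp (fiber B p A) (R w) (R v)"
      by (simp add: fiber_def)
  qed
qed

lemma naturally_isomorphic_refl:
  assumes "category D" "is_functor C D S"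
  shows "naturally_isomorphic C D S S"
proof -
  interpret D: cat D by unfold_locales fact
  have iso: "iso D (Idn D A)" if "A \<in> Ob D" for A
    using that by (auto simp: iso_def in_hom_iff)
  show ?thesis
    unfolding naturally_isomorphic_def using assms(2)
    by (intro exI[of _ "\<lambda>A. Idn D (Fo S A)"]) (auto simp: is_functor_def in_hom_iff iso)
qed

text \<open>Reduces every \<open>\<approx>\<close> of a code structure to an equation. The content
  is that reindexing along the pairing of the identity with \<open>f\<close> is a functor, so that
  its identity transformation exists.\<close>

lemma (in finite_limit_category) approx_refl:
  assumes "cloven_fibration B p" "f \<in> Mor B"
  shows "approx B (Pr1 B) (Pr2 B) p f f"
proof -
  define u where "u = tup B (Idn B (Dom B f)) f"
  have "u \<in> hom B (Dom B f) (Dom B (Pr1 B (Dom B f) (Cod B f)))"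
    using assms tup_simps[of "Idn B (Dom B f)" f] by (simp add: u_def in_hom_iff)
  then show ?thesis
    using assms
    by (simp add: approx_def in_hom_iff Let_def flip: tup_def u_def)
       (intro naturally_isomorphic_refl is_functor_reindex category_fiber, auto simp: in_hom_iff)
qed

section \<open>The representable fibration\<close>

lemma dom_fibration_simps:
  "Tot (dom_fibration B D) = slice B D" "Fo (Prj (dom_fibration B D)) = Dom B"
  "Fm (Prj (dom_fibration B D)) (g, h, g') = h"
  "Lift (dom_fibration B D) f X = (Comp B X f, f, X)"
  by (simp_all add: dom_fibration_def)

context cat
begin

text \<open>The membership rule is solved for the source, as \<open>g = g' \<cdot> h\<close>, so
  that simplification can eliminate it.\<close>

lemma slice_simps:
  "Ob (slice B D) = {g \<in> Mor B. Cod B g = D}"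
  "(g, h, g') \<in> Mor (slice B D) \<longleftrightarrow>
     g' \<in> Mor B \<and> Cod B g' = D \<and> h \<in> Mor B \<and> Cod B h = Dom B g' \<and> g = g' \<cdot> h"
  "Dom (slice B D) (g, h, g') = g" "Cod (slice B D) (g, h, g') = g'"
  "Idn (slice B D) g = (g, Idn B (Dom B g), g)"
  "Comp (slice B D) (g1, h, g2) (g0, k, g1') = (g0, h \<cdot> k, g2)"
proof -
  have "g \<in> Mor B \<and> Cod B g = D \<and> Dom B h = Dom B g \<and> g' \<cdot> h = g \<longleftrightarrow> g = g' \<cdot> h"
    if "g' \<in> Mor B" "Cod B g' = D" "h \<in> Mor B" "Cod B h = Dom B g'"
    using that Comp_simps[of h g'] by metis
  then show "(g, h, g') \<in> Mor (slice B D) \<longleftrightarrow>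
      g' \<in> Mor B \<and> Cod B g' = D \<and> h \<in> Mor B \<and> Cod B h = Dom B g' \<and> g = g' \<cdot> h"
    unfolding slice_def by (auto simp only: cat.simps in_hom_iff mem_Collect_eq prod.case)
qed (simp_all add: slice_def)

lemma category_slice: "category (slice B D)"
  by (auto simp: category_def slice_simps in_hom_iff)

text \<open>Factorizations are forced: source and target are prescribed by the hom-set, the middle
  component by the projection.\<close>

lemma cloven_fibration_dom:
  assumes "D \<in> Ob B"
  shows "cloven_fibration B (dom_fibration B D)"
  unfolding cloven_fibration_def
proof (intro conjI ballI impI is_category)
  let ?p = "dom_fibration B D"
  show "category (Tot ?p)" by (simp add: dom_fibration_simps category_slice)
  show "is_functor (Tot ?p) B (Prj ?p)"
    by (auto simp: is_functor_def dom_fibration_simps slice_simps in_hom_iff)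
  fix f X assume f: "f \<in> Mor B" and "X \<in> Ob (Tot ?p)" "Fo (Prj ?p) X = Cod B f"
  then have X: "X \<in> Mor B" "Cod B X = D" "Dom B X = Cod B f"
    by (auto simp: dom_fibration_simps slice_simps)
  show "Cod (Tot ?p) (Lift ?p f X) = X" "Fm (Prj ?p) (Lift ?p f X) = f"
    by (auto simp: dom_fibration_simps slice_simps)
  show "cartesian B ?p (Lift ?p f X)"
    unfolding cartesian_def dom_fibration_simps slice_simps(3,4)
  proof (intro conjI ballI impI)
    show "(X \<cdot> f, f, X) \<in> Mor (slice B D)"
      using f X by (simp add: slice_simps)
    fix \<psi> h
    assume \<psi>: "\<psi> \<in> Mor (slice B D)" and h: "h \<in> hom B (Dom B (Dom (slice B D) \<psi>)) (Dom B (X \<cdot> f))"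
      and c: "Cod (slice B D) \<psi> = X \<and> f \<cdot> h = Fm (Prj ?p) \<psi>"
    obtain g k X' where e: "\<psi> = (g, k, X')" by (metis prod_cases3)
    have g: "X' = X" "k = f \<cdot> h" "h \<in> Mor B" "Cod B h = Dom B f" "g = X \<cdot> f \<cdot> h"
      using \<psi> h c f X unfolding e by (simp_all add: slice_simps dom_fibration_simps in_hom_iff)
    show "\<exists>!\<chi>. \<chi> \<in> hom (slice B D) (Dom (slice B D) \<psi>) (X \<cdot> f) \<and>
        Fm (Prj ?p) \<chi> = h \<and> Comp (slice B D) (X \<cdot> f, f, X) \<chi> = \<psi>"
    proof (rule ex1I[of _ "(g, h, X \<cdot> f)"])
      show "(g, h, X \<cdot> f) \<in> hom (slice B D) (Dom (slice B D) \<psi>) (X \<cdot> f) \<and>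
          Fm (Prj ?p) (g, h, X \<cdot> f) = h \<and> Comp (slice B D) (X \<cdot> f, f, X) (g, h, X \<cdot> f) = \<psi>"
        using f X g unfolding e by (simp add: slice_simps dom_fibration_simps in_hom_iff)
    next
      fix \<chi>
      assume "\<chi> \<in> hom (slice B D) (Dom (slice B D) \<psi>) (X \<cdot> f) \<and>
          Fm (Prj ?p) \<chi> = h \<and> Comp (slice B D) (X \<cdot> f, f, X) \<chi> = \<psi>"
      then show "\<chi> = (g, h, X \<cdot> f)"
        unfolding e by (cases \<chi>) (simp add: slice_simps dom_fibration_simps in_hom_iff)
    qed
  qed
qed

end

section \<open>The codomain fibration\<close>

lemma (in finite_limit_category) cloven_fibration_cod: "cloven_fibration B (cod_fibration B)"
  unfolding cloven_fibration_def
proof (intro conjI ballI impI is_category)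
  \<comment> \<open>Pasting of commuting squares, which closes the arrow category under
    composition.\<close>
  have sq: "g2 \<cdot> u \<cdot> u' = v \<cdot> v' \<cdot> g0"
    if "g0 \<in> Mor B" "g1 \<in> Mor B" "g2 \<in> Mor B" "u \<in> Mor B" "v \<in> Mor B" "u' \<in> Mor B" "v' \<in> Mor B"
      "Dom B u' = Dom B g0" "Cod B u' = Dom B g1" "Dom B u = Dom B g1" "Cod B u = Dom B g2"
      "Dom B v' = Cod B g0" "Cod B v' = Cod B g1" "Dom B v = Cod B g1" "Cod B v = Cod B g2"
      "g2 \<cdot> u = v \<cdot> g1" "g1 \<cdot> u' = v' \<cdot> g0" for g0 g1 g2 u v u' v'
    using that Comp_cong_assoc[of g2 u v g1 u'] by simp
  show "category (Tot (cod_fibration B))"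
    by (auto simp: category_def cod_fibration_def arrow_cat_def in_hom_iff intro: sq)
  show "is_functor (Tot (cod_fibration B)) B (Prj (cod_fibration B))"
    by (auto simp: is_functor_def cod_fibration_def arrow_cat_def in_hom_iff)
next
  fix f X assume "f \<in> Mor B" "X \<in> Ob (Tot (cod_fibration B))" "Fo (Prj (cod_fibration B)) X = Cod B f"
  then have X: "f \<in> Mor B" "X \<in> Mor B" "Cod B X = Cod B f"
    by (auto simp: cod_fibration_def arrow_cat_def)
  show "Cod (Tot (cod_fibration B)) (Lift (cod_fibration B) f X) = X"
    "Fm (Prj (cod_fibration B)) (Lift (cod_fibration B) f X) = f"
    by (auto simp: cod_fibration_def arrow_cat_def)
  show "cartesian B (cod_fibration B) (Lift (cod_fibration B) f X)"
    unfolding cartesian_def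
  proof (intro conjI ballI impI)
    show "Lift (cod_fibration B) f X \<in> Mor (Tot (cod_fibration B))"
      using X by (auto simp: cod_fibration_def arrow_cat_def in_hom_iff Pb_comm)
  next
    fix \<psi> h
    assume \<psi>: "\<psi> \<in> Mor (Tot (cod_fibration B))"
      and h: "h \<in> hom B (Fo (Prj (cod_fibration B)) (Dom (Tot (cod_fibration B)) \<psi>))
             (Fo (Prj (cod_fibration B)) (Dom (Tot (cod_fibration B)) (Lift (cod_fibration B) f X)))"
      and c: "Cod (Tot (cod_fibration B)) \<psi> =
             Cod (Tot (cod_fibration B)) (Lift (cod_fibration B) f X) \<and>
           Fm (Prj (cod_fibration B)) (Lift (cod_fibration B) f X) \<cdot> h = Fm (Prj (cod_fibration B)) \<psi>"
    obtain g u v X' where e: "\<psi> = (g, u, v, X')" by (metis prod_cases4)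
    have 1: "X' = X" "X \<in> Mor B" "g \<in> Mor B" "u \<in> Mor B" "Dom B u = Dom B g" "Cod B u = Dom B X"
      "v = f \<cdot> h" "X \<cdot> u = v \<cdot> g" "h \<in> Mor B" "Dom B h = Cod B g" "Cod B h = Dom B f"
      using \<psi> h c X unfolding e by (auto simp: cod_fibration_def arrow_cat_def in_hom_iff)
    \<comment> \<open>Uniqueness of the top component of a factorization: the lift of
      \<open>f\<close> is a chosen pullback square, and both projections are fixed.\<close>
    have m: "m = med B X f u (h \<cdot> g)"
      if "m \<in> Mor B" "Cod B m = Dom B (Pb1 B X f)" "Pb1 B X f \<cdot> m = u" "Pb2 B X f \<cdot> m = h \<cdot> g" for m
      by (rule Pb_joint_mono[of X f]) (use that 1 X in simp_all)
    show "\<exists>!\<chi>. \<chi> \<in> hom (Tot (cod_fibration B)) (Dom (Tot (cod_fibration B)) \<psi>)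
              (Dom (Tot (cod_fibration B)) (Lift (cod_fibration B) f X)) \<and>
            Fm (Prj (cod_fibration B)) \<chi> = h \<and>
            Comp (Tot (cod_fibration B)) (Lift (cod_fibration B) f X) \<chi> = \<psi>"
      \<comment> \<open>The cone \<open>u\<close>, \<open>h \<cdot> g\<close> commutes because
        \<open>X \<cdot> u = v \<cdot> g\<close> and \<open>v = f \<cdot> h\<close>.\<close>
      using 1 X unfolding e
      by (intro ex1I[of _ "(g, med B X f u (h \<cdot> g), h, Pb2 B X f)"])
        (auto simp: cod_fibration_def arrow_cat_def in_hom_iff dest: m)
  qed
qed

section \<open>Families of internal morphisms\<close>

text \<open>Morphisms \<open>I \<rightarrow> iMor C\<close> are treated as \<open>I\<close>-indexed families of morphisms of \<open>C\<close>; the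
  axioms, stated on generic elements, are transferred to families by precomposition.\<close>

locale internal_finite_limit_category = finite_limit_category B for B :: "('o, 'm, 'z) flcat_scheme" (structure) +
  fixes C :: "('o, 'm, 'y) flicat_scheme"
  assumes has_internal_limits: "has_internal_chosen_finite_limits B C"
begin

section \<open>Internal composition on families\<close>

lemma internal_category_C: "internal_category B C"
  using has_internal_limits by (simp add: has_internal_chosen_finite_limits_def)

lemmas internal_category_unfolded =
  internal_category_C[unfolded internal_category_def Let_def in_hom_iff]

lemma icat_simps [simp]:
  "iObj C \<in> Ob B" "iMor C \<in> Ob B"
  "iDom C \<in> Mor B" "Dom B (iDom C) = iMor C" "Cod B (iDom C) = iObj C"
  "iCod C \<in> Mor B" "Dom B (iCod C) = iMor C" "Cod B (iCod C) = iObj C"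
  "iId C \<in> Mor B" "Dom B (iId C) = iObj C" "Cod B (iId C) = iMor C"
  "iComp C \<in> Mor B" "Dom B (iComp C) = Dom B (Pb1 B (iDom C) (iCod C))" "Cod B (iComp C) = iMor C"
  using internal_category_unfolded by auto

lemma iDom_iId [simp]:
  assumes "x \<in> Mor B" "Cod B x = iObj C"
  shows "iDom C \<cdot> iId C \<cdot> x = x" "iCod C \<cdot> iId C \<cdot> x = x"
proof -
  have "iDom C \<cdot> iId C \<cdot> x = Idn B (iObj C) \<cdot> x" "iCod C \<cdot> iId C \<cdot> x = Idn B (iObj C) \<cdot> x"
    using internal_category_unfolded assms by (simp_all flip: Comp_assoc)
  with assms show "iDom C \<cdot> iId C \<cdot> x = x" "iCod C \<cdot> iId C \<cdot> x = x" by simp_all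
qed

lemma icomp_simps [simp]:
  assumes "g \<in> Mor B" "f \<in> Mor B" "Cod B g = iMor C" "Cod B f = iMor C" "Dom B g = Dom B f"
    "iDom C \<cdot> g = iCod C \<cdot> f"
  shows "icomp B C g f \<in> Mor B" "Dom B (icomp B C g f) = Dom B f" "Cod B (icomp B C g f) = iMor C"
    "iDom C \<cdot> icomp B C g f = iDom C \<cdot> f" "iCod C \<cdot> icomp B C g f = iCod C \<cdot> g"
proof -
  let ?m = "med B (iDom C) (iCod C) g f"
  have "iDom C \<cdot> iComp C \<cdot> ?m = iDom C \<cdot> Pb2 B (iDom C) (iCod C) \<cdot> ?m"
    "iCod C \<cdot> iComp C \<cdot> ?m = iCod C \<cdot> Pb1 B (iDom C) (iCod C) \<cdot> ?m"
    by (rule Comp_cong_assoc; use internal_category_unfolded assms in simp)+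
  with assms show "icomp B C g f \<in> Mor B" "Dom B (icomp B C g f) = Dom B f"
    "Cod B (icomp B C g f) = iMor C" "iDom C \<cdot> icomp B C g f = iDom C \<cdot> f"
    "iCod C \<cdot> icomp B C g f = iCod C \<cdot> g"
    by (simp_all add: icomp_def)
qed

text \<open>Composition of families is stable under reindexing, by \<open>med_Comp\<close>. Together
  with \<open>Comp_cong_assoc\<close> this evaluates the axioms of \<open>C\<close> on arbitrary
  families.\<close>

lemma icomp_Comp:
  assumes "g \<in> Mor B" "f \<in> Mor B" "Cod B g = iMor C" "Cod B f = iMor C" "Dom B g = Dom B f"
    "iDom C \<cdot> g = iCod C \<cdot> f" "x \<in> Mor B" "Cod B x = Dom B f"
  shows "icomp B C g f \<cdot> x = icomp B C (g \<cdot> x) (f \<cdot> x)"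
  using assms by (simp add: icomp_def med_Comp)

lemma icomp_id_right:
  assumes "f \<in> Mor B" "Cod B f = iMor C"
  shows "icomp B C f (iId C \<cdot> iDom C \<cdot> f) = f"
proof -
  have "icomp B C (Idn B (iMor C)) (iId C \<cdot> iDom C) \<cdot> f = f"
    using internal_category_unfolded assms by simp
  with assms show ?thesis by (simp add: icomp_Comp)
qed

text \<open>A composable triple of families is one morphism \<open>?m\<close> into the object of
  generic triples; the law is the associativity axiom precomposed with it.\<close>

lemma icomp_assoc:
  assumes "f \<in> Mor B" "g \<in> Mor B" "h \<in> Mor B"
    "Cod B f = iMor C" "Cod B g = iMor C" "Cod B h = iMor C"
    "Dom B g = Dom B f" "Dom B h = Dom B f" "iDom C \<cdot> g = iCod C \<cdot> f" "iDom C \<cdot> h = iCod C \<cdot> g"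
  shows "icomp B C (icomp B C h g) f = icomp B C h (icomp B C g f)"
proof -
  let ?p1 = "Pb1 B (iDom C) (iCod C)" and ?p2 = "Pb2 B (iDom C) (iCod C)"
  let ?t1 = "Pb1 B ?p2 ?p1" and ?t2 = "Pb2 B ?p2 ?p1"
  let ?hg = "med B (iDom C) (iCod C) h g" and ?gf = "med B (iDom C) (iCod C) g f"
  let ?m = "med B ?p2 ?p1 ?hg ?gf"
  have t: "?p2 \<cdot> ?t1 = ?p1 \<cdot> ?t2" by (rule Pb_comm) simp_all
  have d: "iDom C \<cdot> iComp C = iDom C \<cdot> ?p2" "iCod C \<cdot> iComp C = iCod C \<cdot> ?p1"
    and a: "icomp B C (iComp C \<cdot> ?t1) (?p2 \<cdot> ?t2) = icomp B C (?p1 \<cdot> ?t1) (iComp C \<cdot> ?t2)"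
    using internal_category_unfolded by auto
  have p: "iDom C \<cdot> ?p1 = iCod C \<cdot> ?p2" by (rule Pb_comm) simp_all
  \<comment> \<open>This equation and the next are the composability conditions that
    \<open>icomp_Comp\<close> demands for the two sides of the axiom. Both rest on \<open>t\<close>:
    the two pairs of a generic triple share its middle morphism.\<close>
  have 1: "iDom C \<cdot> iComp C \<cdot> ?t1 = iCod C \<cdot> ?p2 \<cdot> ?t2"
  proof -
    have "iDom C \<cdot> iComp C \<cdot> ?t1 = iDom C \<cdot> ?p2 \<cdot> ?t1"
      by (rule Comp_cong_assoc) (use d in simp_all)
    also have "\<dots> = iDom C \<cdot> ?p1 \<cdot> ?t2" by (simp add: t)
    also have "\<dots> = iCod C \<cdot> ?p2 \<cdot> ?t2"
      by (rule Comp_cong_assoc) (use p in simp_all)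
    finally show ?thesis .
  qed
  have 2: "iDom C \<cdot> ?p1 \<cdot> ?t1 = iCod C \<cdot> iComp C \<cdot> ?t2"
  proof -
    have "iCod C \<cdot> iComp C \<cdot> ?t2 = iCod C \<cdot> ?p1 \<cdot> ?t2"
      by (rule Comp_cong_assoc) (use d in simp_all)
    also have "\<dots> = iCod C \<cdot> ?p2 \<cdot> ?t1" by (simp add: t)
    also have "\<dots> = iDom C \<cdot> ?p1 \<cdot> ?t1"
      by (rule Comp_cong_assoc) (use p in simp_all)
    finally show ?thesis by simp
  qed
  have m: "?m \<in> Mor B" "Cod B ?m = Dom B ?t1" "Dom B ?m = Dom B f" "?t1 \<cdot> ?m = ?hg" "?t2 \<cdot> ?m = ?gf"
    using assms by simp_all
  have "icomp B C (iComp C \<cdot> ?t1) (?p2 \<cdot> ?t2) \<cdot> ?m = icomp B C (icomp B C h g) f"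
    using assms m(1-3) by (subst icomp_Comp) (simp_all add: 1 m(4,5) icomp_def del: Pb1_med_Comp)
  moreover have "icomp B C (?p1 \<cdot> ?t1) (iComp C \<cdot> ?t2) \<cdot> ?m = icomp B C h (icomp B C g f)"
    using assms m(1-3) by (subst icomp_Comp) (simp_all add: 2 m(4,5) icomp_def del: Pb1_med_Comp)
  ultimately show ?thesis by (simp only: a)
qed

section \<open>The internal terminal object and internal pullbacks on families\<close>

lemma iOne_simps [simp]: "iOne C \<in> Mor B" "Dom B (iOne C) = One B" "Cod B (iOne C) = iObj C"
  using has_internal_limits
  by (auto simp: has_internal_chosen_finite_limits_def internal_chosen_terminal_def Let_def in_hom_iff)

text \<open>The axiom recovers the generic morphism into \<open>iOne C\<close> from its domain by
  \<open>iBang C\<close>. Every family into \<open>iOne C\<close> factors through the generic one,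
  so it too is determined by its domain.\<close>

lemma to_iOne_unique:
  assumes "f \<in> Mor B" "g \<in> Mor B" "Cod B f = iMor C" "Cod B g = iMor C" "Dom B f = Dom B g"
    "iCod C \<cdot> f = iOne C \<cdot> bang B (Dom B f)" "iCod C \<cdot> g = iOne C \<cdot> bang B (Dom B f)"
    "iDom C \<cdot> f = iDom C \<cdot> g"
  shows "f = g"
proof -
  let ?i = "Pb1 B (iCod C) (iOne C)"
  have i: "iBang C \<in> Mor B" "Dom B (iBang C) = iObj C" "Cod B (iBang C) = iMor C"
     "iBang C \<cdot> iDom C \<cdot> ?i = ?i"
    using has_internal_limits
    by (auto simp: has_internal_chosen_finite_limits_def internal_chosen_terminal_def Let_def in_hom_iff)
  have *: "x = iBang C \<cdot> iDom C \<cdot> x"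
    if x: "x \<in> Mor B" "Cod B x = iMor C" "iCod C \<cdot> x = iOne C \<cdot> bang B (Dom B x)" for x
  proof -
    let ?m = "med B (iCod C) (iOne C) x (bang B (Dom B x))"
    have "(iBang C \<cdot> iDom C \<cdot> ?i) \<cdot> ?m = ?i \<cdot> ?m" by (simp only: i)
    with x i(1-3) show ?thesis by simp
  qed
  show ?thesis using *[of f] *[of g] assms by simp
qed

text \<open>On global elements these terms are the components \<open>Pb1\<close> and
  \<open>Pb2\<close> of \<open>Gamma B C\<close>, so strict preservation of pullbacks by
  \<open>F\<close> can be stated through them.\<close>

abbreviation "pb1 a b \<equiv> iPb1 C \<cdot> med B (iCod C) (iCod C) a b"
abbreviation "pb2 a b \<equiv> iPb2 C \<cdot> med B (iCod C) (iCod C) a b"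

lemmas internal_pullbacks_unfolded =
  has_internal_limits[unfolded has_internal_chosen_finite_limits_def internal_chosen_pullbacks_def
    Let_def in_hom_iff, THEN conjunct2, THEN conjunct2]

lemma flicat_simps [simp]:
  "iPb1 C \<in> Mor B" "Dom B (iPb1 C) = Dom B (Pb1 B (iCod C) (iCod C))" "Cod B (iPb1 C) = iMor C"
  "iPb2 C \<in> Mor B" "Dom B (iPb2 C) = Dom B (Pb1 B (iCod C) (iCod C))" "Cod B (iPb2 C) = iMor C"
  "iMed C \<in> Mor B" "Dom B (iMed C) = Dom B (Pb1 B (iComp C) (iComp C))" "Cod B (iMed C) = iMor C"
  using internal_pullbacks_unfolded by blast+

text \<open>Each equation comes from an axiom on the generic cospan, precomposed with the morphism
  naming \<open>(a, b)\<close>.\<close>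

lemma pb_simps:
  assumes "a \<in> Mor B" "b \<in> Mor B" "Cod B a = iMor C" "Cod B b = iMor C" "Dom B a = Dom B b"
    "iCod C \<cdot> a = iCod C \<cdot> b"
  shows "iCod C \<cdot> pb1 a b = iDom C \<cdot> a" "iCod C \<cdot> pb2 a b = iDom C \<cdot> b"
    "iDom C \<cdot> pb1 a b = iDom C \<cdot> pb2 a b" "icomp B C a (pb1 a b) = icomp B C b (pb2 a b)"
proof -
  let ?k1 = "Pb1 B (iCod C) (iCod C)" and ?k2 = "Pb2 B (iCod C) (iCod C)"
    and ?m = "med B (iCod C) (iCod C) a b"
  have k: "iCod C \<cdot> iPb1 C = iDom C \<cdot> ?k1" "iCod C \<cdot> iPb2 C = iDom C \<cdot> ?k2"
    "iDom C \<cdot> iPb1 C = iDom C \<cdot> iPb2 C" "icomp B C ?k1 (iPb1 C) = icomp B C ?k2 (iPb2 C)"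
    using internal_pullbacks_unfolded by blast+
  have m: "?m \<in> Mor B" "Cod B ?m = Dom B ?k1" "Dom B ?m = Dom B b" using assms by simp_all
  have "iCod C \<cdot> pb1 a b = iDom C \<cdot> ?k1 \<cdot> ?m" "iCod C \<cdot> pb2 a b = iDom C \<cdot> ?k2 \<cdot> ?m"
    "iDom C \<cdot> pb1 a b = iDom C \<cdot> pb2 a b"
    by (rule Comp_cong_assoc; use k m in simp)+
  with assms show c: "iCod C \<cdot> pb1 a b = iDom C \<cdot> a" "iCod C \<cdot> pb2 a b = iDom C \<cdot> b"
    "iDom C \<cdot> pb1 a b = iDom C \<cdot> pb2 a b" by simp_all
  have "icomp B C ?k1 (iPb1 C) \<cdot> ?m = icomp B C ?k2 (iPb2 C) \<cdot> ?m" by (simp only: k)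
  then show "icomp B C a (pb1 a b) = icomp B C b (pb2 a b)"
    using k(1-3) m assms by (simp add: icomp_Comp)
qed

text \<open>The axiom on \<open>iMed\<close> recovers a family \<open>m\<close> into a pullback from its two composites.\<close>

lemma pb_unique:
  assumes "a \<in> Mor B" "b \<in> Mor B" "Cod B a = iMor C" "Cod B b = iMor C" "Dom B a = Dom B b"
    "iCod C \<cdot> a = iCod C \<cdot> b"
    and m: "m \<in> Mor B" "Cod B m = iMor C" "Dom B m = Dom B b" "iCod C \<cdot> m = iDom C \<cdot> pb1 a b"
    and m': "m' \<in> Mor B" "Cod B m' = iMor C" "Dom B m' = Dom B b" "iCod C \<cdot> m' = iDom C \<cdot> pb1 a b"
    and "icomp B C (pb1 a b) m = icomp B C (pb1 a b) m'" "icomp B C (pb2 a b) m = icomp B C (pb2 a b) m'"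
  shows "m = m'"
proof -
  let ?k1 = "Pb1 B (iCod C) (iCod C)" and ?k2 = "Pb2 B (iCod C) (iCod C)"
  let ?apex = "iDom C \<cdot> iPb1 C" and ?ab = "med B (iCod C) (iCod C) a b"
  let ?w1 = "Pb1 B ?apex (iCod C)" and ?w2 = "Pb2 B ?apex (iCod C)"
  let ?c1 = "icomp B C (iPb1 C \<cdot> ?w1) ?w2" and ?c2 = "icomp B C (iPb2 C \<cdot> ?w1) ?w2"
  let ?l1 = "med B (iDom C) (iCod C) (?k1 \<cdot> ?w1) ?c1"
  let ?l2 = "med B (iDom C) (iCod C) (?k2 \<cdot> ?w1) ?c2"
  have k: "iCod C \<cdot> iPb1 C = iDom C \<cdot> ?k1" "iCod C \<cdot> iPb2 C = iDom C \<cdot> ?k2"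
    "iDom C \<cdot> iPb1 C = iDom C \<cdot> iPb2 C" "icomp B C ?k1 (iPb1 C) = icomp B C ?k2 (iPb2 C)"
    and med: "iMed C \<cdot> med B (iComp C) (iComp C) ?l1 ?l2 = ?w2"
    using internal_pullbacks_unfolded by blast+
  have w0: "?apex \<cdot> ?w1 = iCod C \<cdot> ?w2" by (rule Pb_comm) simp_all
  have w: "iDom C \<cdot> iPb1 C \<cdot> ?w1 = iCod C \<cdot> ?w2" using w0 by simp
  have w': "iDom C \<cdot> iPb2 C \<cdot> ?w1 = iCod C \<cdot> ?w2"
    using w Comp_cong_assoc[OF k(3), of ?w1] by simp
  have c1: "iDom C \<cdot> ?k1 \<cdot> ?w1 = iCod C \<cdot> ?c1"
    using w Comp_cong_assoc[OF k(1), of ?w1] by simp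
  have c2: "iDom C \<cdot> ?k2 \<cdot> ?w1 = iCod C \<cdot> ?c2"
    using w' Comp_cong_assoc[OF k(2), of ?w1] by simp
  have l: "?l1 \<in> Mor B" "Dom B ?l1 = Dom B ?w1" "Cod B ?l1 = Dom B (iComp C)"
    "?l2 \<in> Mor B" "Dom B ?l2 = Dom B ?w1" "Cod B ?l2 = Dom B (iComp C)"
    using c1 c2 w w' by simp_all
  \<comment> \<open>Composing the generic pullback square with \<open>?w2\<close> shows that the
    pair \<open>(?l1, ?l2)\<close> is an element of the object of commuting squares, so that the
    argument of \<open>iMed C\<close> is well formed.\<close>
  have ll: "iComp C \<cdot> ?l1 = iComp C \<cdot> ?l2"
  proof -
    have "iComp C \<cdot> ?l1 = icomp B C (?k1 \<cdot> ?w1) ?c1" by (simp add: icomp_def)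
    also have "\<dots> = icomp B C (icomp B C (?k1 \<cdot> ?w1) (iPb1 C \<cdot> ?w1)) ?w2"
      by (rule icomp_assoc[symmetric]) (use w Comp_cong_assoc[OF k(1), of ?w1] in simp_all)
    also have "icomp B C (?k1 \<cdot> ?w1) (iPb1 C \<cdot> ?w1) = icomp B C ?k1 (iPb1 C) \<cdot> ?w1"
      by (rule icomp_Comp[symmetric]) (use k in simp_all)
    also have "\<dots> = icomp B C ?k2 (iPb2 C) \<cdot> ?w1" by (simp only: k)
    also have "\<dots> = icomp B C (?k2 \<cdot> ?w1) (iPb2 C \<cdot> ?w1)"
      by (rule icomp_Comp) (use k in simp_all)
    also have "icomp B C \<dots> ?w2 = icomp B C (?k2 \<cdot> ?w1) ?c2"
      by (rule icomp_assoc) (use w' Comp_cong_assoc[OF k(2), of ?w1] in simp_all)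
    also have "\<dots> = iComp C \<cdot> ?l2" by (simp add: icomp_def)
    finally show ?thesis .
  qed
  \<comment> \<open>The right side depends on \<open>x\<close> only through its two composites,
    which is why their equality suffices.\<close>
  have rec: "x = iMed C \<cdot> med B (iComp C) (iComp C)
      (med B (iDom C) (iCod C) a (icomp B C (pb1 a b) x))
      (med B (iDom C) (iCod C) b (icomp B C (pb2 a b) x))"
    if x: "x \<in> Mor B" "Cod B x = iMor C" "Dom B x = Dom B b" "iCod C \<cdot> x = iDom C \<cdot> pb1 a b" for x
  proof -
    \<comment> \<open>This pairs the cospan \<open>(a, b)\<close> with \<open>x\<close>, as an
      element of the object on which the uniqueness axiom is stated.\<close>
    let ?w = "med B ?apex (iCod C) ?ab x"
    have m: "?w \<in> Mor B" "Cod B ?w = Dom B ?w1" "Dom B ?w = Dom B b" "?w1 \<cdot> ?w = ?ab" "?w2 \<cdot> ?w = x"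
      using x assms(1-6) by simp_all
    have ab: "?ab \<in> Mor B" "Dom B ?ab = Dom B b" "Cod B ?ab = Dom B ?k1"
      "?k1 \<cdot> ?ab = a" "?k2 \<cdot> ?ab = b"
      using assms(1-6) by simp_all
    have cc: "?c1 \<cdot> ?w = icomp B C (pb1 a b) x" "?c2 \<cdot> ?w = icomp B C (pb2 a b) x"
      using m w w' by (simp_all add: icomp_Comp del: Pb1_med_Comp)
    have "?l1 \<cdot> ?w = med B (iDom C) (iCod C) ((?k1 \<cdot> ?w1) \<cdot> ?w) (?c1 \<cdot> ?w)"
      by (rule med_Comp) (use c1 w m in simp_all)
    then have l1: "?l1 \<cdot> ?w = med B (iDom C) (iCod C) a (icomp B C (pb1 a b) x)"
      using m ab by (simp add: cc del: Pb1_med_Comp)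
    have "?l2 \<cdot> ?w = med B (iDom C) (iCod C) ((?k2 \<cdot> ?w1) \<cdot> ?w) (?c2 \<cdot> ?w)"
      by (rule med_Comp) (use c2 w' m in simp_all)
    then have l2: "?l2 \<cdot> ?w = med B (iDom C) (iCod C) b (icomp B C (pb2 a b) x)"
      using m ab by (simp add: cc del: Pb1_med_Comp)
    have "x = (iMed C \<cdot> med B (iComp C) (iComp C) ?l1 ?l2) \<cdot> ?w" using m by (simp only: med)
    also have "\<dots> = iMed C \<cdot> med B (iComp C) (iComp C) ?l1 ?l2 \<cdot> ?w"
      by (rule Comp_assoc) (use m l ll in simp_all)
    also have "med B (iComp C) (iComp C) ?l1 ?l2 \<cdot> ?w = med B (iComp C) (iComp C) (?l1 \<cdot> ?w) (?l2 \<cdot> ?w)"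
      by (rule med_Comp) (use m l ll in simp_all)
    finally show ?thesis unfolding l1 l2 .
  qed
  show ?thesis using rec[OF m] rec[OF m'] assms(15,16) by simp
qed

text \<open>The square is named by a morphism \<open>?n\<close> into the object of generic commuting
  squares, and \<open>iMed C \<cdot> ?n\<close> mediates. The conclusion records the domain because
  the family must later be recognized as one out of \<open>iOne C\<close>.\<close>

lemma pb_exists:
  assumes "a \<in> Mor B" "b \<in> Mor B" "Cod B a = iMor C" "Cod B b = iMor C" "Dom B a = Dom B b"
    "iCod C \<cdot> a = iCod C \<cdot> b"
    and "u \<in> Mor B" "Cod B u = iMor C" "Dom B u = Dom B b" "iCod C \<cdot> u = iDom C \<cdot> a"
    and "v \<in> Mor B" "Cod B v = iMor C" "Dom B v = Dom B b" "iCod C \<cdot> v = iDom C \<cdot> b"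
    and "icomp B C a u = icomp B C b v"
  shows "\<exists>m. m \<in> Mor B \<and> Cod B m = iMor C \<and> Dom B m = Dom B b \<and>
    iCod C \<cdot> m = iDom C \<cdot> pb1 a b \<and> iDom C \<cdot> m = iDom C \<cdot> u \<and>
    icomp B C (pb1 a b) m = u \<and> icomp B C (pb2 a b) m = v"
proof -
  let ?p1 = "Pb1 B (iDom C) (iCod C)" and ?p2 = "Pb2 B (iDom C) (iCod C)"
  let ?s1 = "Pb1 B (iComp C) (iComp C)" and ?s2 = "Pb2 B (iComp C) (iComp C)"
  let ?ab = "med B (iCod C) (iCod C) (?p1 \<cdot> ?s1) (?p1 \<cdot> ?s2)"
  have p: "iDom C \<cdot> iMed C = iDom C \<cdot> ?p2 \<cdot> ?s1"
    "iCod C \<cdot> iMed C = iDom C \<cdot> iPb1 C \<cdot> ?ab"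
    "icomp B C (iPb1 C \<cdot> ?ab) (iMed C) = ?p2 \<cdot> ?s1"
    "icomp B C (iPb2 C \<cdot> ?ab) (iMed C) = ?p2 \<cdot> ?s2"
    and k: "iDom C \<cdot> iPb1 C = iDom C \<cdot> iPb2 C"
    using internal_pullbacks_unfolded by blast+
  let ?n1 = "med B (iDom C) (iCod C) a u" and ?n2 = "med B (iDom C) (iCod C) b v"
  let ?n = "med B (iComp C) (iComp C) ?n1 ?n2"
  have n: "?n \<in> Mor B" "Dom B ?n = Dom B b" "Cod B ?n = Dom B ?s1" "?s1 \<cdot> ?n = ?n1" "?s2 \<cdot> ?n = ?n2"
    using assms by (simp_all add: icomp_def)
  have n': "?n1 \<in> Mor B" "?p1 \<cdot> ?n1 = a" "?p2 \<cdot> ?n1 = u" "?n2 \<in> Mor B" "?p1 \<cdot> ?n2 = b" "?p2 \<cdot> ?n2 = v"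
    using assms by simp_all
  have cc: "iCod C \<cdot> iComp C = iCod C \<cdot> ?p1"
    using internal_category_unfolded by simp
  \<comment> \<open>The outer legs of a generic commuting square form a cospan: their codomains are
    those of the two composites, which coincide.\<close>
  have s: "iCod C \<cdot> ?p1 \<cdot> ?s1 = iCod C \<cdot> ?p1 \<cdot> ?s2"
  proof -
    have "iCod C \<cdot> ?p1 \<cdot> ?s1 = iCod C \<cdot> iComp C \<cdot> ?s1"
      by (rule Comp_cong_assoc) (use cc in simp_all)
    also have "\<dots> = iCod C \<cdot> iComp C \<cdot> ?s2" by (simp add: Pb_comm)
    also have "\<dots> = iCod C \<cdot> ?p1 \<cdot> ?s2"
      by (rule Comp_cong_assoc) (use cc in simp_all)
    finally show ?thesis .
  qed
  have ab: "?ab \<in> Mor B" "Dom B ?ab = Dom B ?s1" "Cod B ?ab = Dom B (Pb1 B (iCod C) (iCod C))"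
    using s by simp_all
  have abn: "?ab \<cdot> ?n = med B (iCod C) (iCod C) a b"
    using s n(1-3) by (simp add: med_Comp n(4,5) n' del: Pb1_med_Comp)
  have k': "iDom C \<cdot> iPb2 C \<cdot> ?ab = iDom C \<cdot> iPb1 C \<cdot> ?ab"
    by (rule Comp_cong_assoc) (use k ab in simp_all)
  show ?thesis
  proof (intro exI[of _ "iMed C \<cdot> ?n"] conjI)
    show "iMed C \<cdot> ?n \<in> Mor B" "Cod B (iMed C \<cdot> ?n) = iMor C" "Dom B (iMed C \<cdot> ?n) = Dom B b"
      using n by simp_all
    have "iCod C \<cdot> iMed C \<cdot> ?n = iDom C \<cdot> (iPb1 C \<cdot> ?ab) \<cdot> ?n"
      by (rule Comp_cong_assoc) (use p n ab in simp_all)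
    then show "iCod C \<cdot> iMed C \<cdot> ?n = iDom C \<cdot> pb1 a b"
      using n(1-3) ab by (simp add: abn)
    have "iDom C \<cdot> iMed C \<cdot> ?n = iDom C \<cdot> (?p2 \<cdot> ?s1) \<cdot> ?n"
      by (rule Comp_cong_assoc) (use p n ab in simp_all)
    then show "iDom C \<cdot> iMed C \<cdot> ?n = iDom C \<cdot> u"
      using n(1-3) by (simp add: n(4,5) n' del: Pb1_med_Comp)
    have "icomp B C (iPb1 C \<cdot> ?ab) (iMed C) \<cdot> ?n = icomp B C (pb1 a b) (iMed C \<cdot> ?n)"
      using n(1-3) ab p(2) by (simp add: icomp_Comp abn)
    then show "icomp B C (pb1 a b) (iMed C \<cdot> ?n) = u"
      using n(1-3) by (simp add: p n(4,5) n' del: Pb1_med_Comp)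
    have "icomp B C (iPb2 C \<cdot> ?ab) (iMed C) \<cdot> ?n = icomp B C (pb2 a b) (iMed C \<cdot> ?n)"
      using n(1-3) ab p(2) k' by (simp add: icomp_Comp abn)
    then show "icomp B C (pb2 a b) (iMed C \<cdot> ?n) = v"
      using n(1-3) by (simp add: p n(4,5) n' del: Pb1_med_Comp)
  qed
qed

section \<open>Hom-objects and factorization through them\<close>

lemma homincl_simps [simp]:
  assumes "X \<in> Mor B" "Dom B X = One B" "Cod B X = iObj C" "Y \<in> Mor B" "Dom B Y = One B" "Cod B Y = iObj C"
  shows "homincl B C X Y \<in> Mor B" "Dom B (homincl B C X Y) = homobj B C X Y"
    "Cod B (homincl B C X Y) = iMor C" "homobj B C X Y \<in> Ob B"
proof -
  show 1: "homincl B C X Y \<in> Mor B" "Dom B (homincl B C X Y) = homobj B C X Y"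
    "Cod B (homincl B C X Y) = iMor C"
    using assms by (simp_all add: homobj_def homincl_def)
  then show "homobj B C X Y \<in> Ob B" by (metis Dom_Cod_in(1))
qed

text \<open>The other projection of the defining pullback ends in \<open>One B\<close>, hence is a
  \<open>bang\<close>; the pullback square then splits over the two factors.\<close>

lemma homincl_iDom [simp]:
  assumes "X \<in> Mor B" "Dom B X = One B" "Cod B X = iObj C" "Y \<in> Mor B" "Dom B Y = One B" "Cod B Y = iObj C"
  shows "iDom C \<cdot> homincl B C X Y = X \<cdot> bang B (homobj B C X Y)"
    "iCod C \<cdot> homincl B C X Y = Y \<cdot> bang B (homobj B C X Y)"
proof -
  let ?q = "Pb2 B (tup B (iDom C) (iCod C)) (tup B X Y)"
  have q: "?q \<in> Mor B" "Cod B ?q = One B" "Dom B ?q = homobj B C X Y"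
    using assms by (simp_all add: homobj_def homincl_def)
  then have "?q = bang B (homobj B C X Y)" using eq_bang by metis
  moreover have "tup B (iDom C) (iCod C) \<cdot> homincl B C X Y = tup B X Y \<cdot> ?q"
    unfolding homincl_def by (rule Pb_comm) (use assms in simp_all)
  ultimately have "tup B (iDom C) (iCod C) \<cdot> homincl B C X Y = tup B X Y \<cdot> bang B (homobj B C X Y)" by simp
  then show "iDom C \<cdot> homincl B C X Y = X \<cdot> bang B (homobj B C X Y)"
    "iCod C \<cdot> homincl B C X Y = Y \<cdot> bang B (homobj B C X Y)"
    using assms by (simp_all add: tup_Comp_eq_iff)
qed

lemma homincl_iDom_Comp [simp]:
  assumes "X \<in> Mor B" "Dom B X = One B" "Cod B X = iObj C" "Y \<in> Mor B" "Dom B Y = One B" "Cod B Y = iObj C"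
    "x \<in> Mor B" "Cod B x = homobj B C X Y"
  shows "iDom C \<cdot> homincl B C X Y \<cdot> x = X \<cdot> bang B (Dom B x)"
    "iCod C \<cdot> homincl B C X Y \<cdot> x = Y \<cdot> bang B (Dom B x)"
proof -
  have "iDom C \<cdot> homincl B C X Y \<cdot> x = X \<cdot> bang B (homobj B C X Y) \<cdot> x"
    by (rule Comp_cong_assoc) (use assms in simp_all)
  then show "iDom C \<cdot> homincl B C X Y \<cdot> x = X \<cdot> bang B (Dom B x)" using assms by simp
  have "iCod C \<cdot> homincl B C X Y \<cdot> x = Y \<cdot> bang B (homobj B C X Y) \<cdot> x"
    by (rule Comp_cong_assoc) (use assms in simp_all)
  then show "iCod C \<cdot> homincl B C X Y \<cdot> x = Y \<cdot> bang B (Dom B x)" using assms by simp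
qed

text \<open>The second projection of the defining pullback ends in a terminal object, so the first
  alone is monic.\<close>

lemma homincl_mono:
  assumes "X \<in> Mor B" "Dom B X = One B" "Cod B X = iObj C" "Y \<in> Mor B" "Dom B Y = One B" "Cod B Y = iObj C"
    "x \<in> Mor B" "Cod B x = homobj B C X Y" "y \<in> Mor B" "Cod B y = homobj B C X Y"
    "homincl B C X Y \<cdot> x = homincl B C X Y \<cdot> y"
  shows "x = y"
proof -
  let ?f = "tup B (iDom C) (iCod C)" and ?g = "tup B X Y"
  have c: "Cod B x = Dom B (Pb1 B ?f ?g)" "Cod B y = Dom B (Pb1 B ?f ?g)"
    "Pb1 B ?f ?g \<cdot> x = Pb1 B ?f ?g \<cdot> y"
    using assms by (simp_all add: homobj_def homincl_def)
  have "Dom B (homincl B C X Y \<cdot> x) = Dom B x" "Dom B (homincl B C X Y \<cdot> y) = Dom B y"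
    using assms(1-10) by simp_all
  with assms(11) have "Dom B x = Dom B y" by simp
  then have "Pb2 B ?f ?g \<cdot> x = Pb2 B ?f ?g \<cdot> y"
    using assms c(1,2) by (intro to_One_unique) simp_all
  then show ?thesis by (intro Pb_joint_mono[of ?f ?g x y]) (use assms c in simp_all)
qed

lemma into_hom_simps [simp]:
  assumes "X \<in> Mor B" "Dom B X = One B" "Cod B X = iObj C" "Y \<in> Mor B" "Dom B Y = One B" "Cod B Y = iObj C"
    "x \<in> Mor B" "Cod B x = iMor C" "iDom C \<cdot> x = X \<cdot> bang B (Dom B x)" "iCod C \<cdot> x = Y \<cdot> bang B (Dom B x)"
  shows "into_hom B C X Y x \<in> Mor B" "Dom B (into_hom B C X Y x) = Dom B x"
    "Cod B (into_hom B C X Y x) = homobj B C X Y" "homincl B C X Y \<cdot> into_hom B C X Y x = x"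
proof -
  have "tup B (iDom C) (iCod C) \<cdot> x = tup B X Y \<cdot> bang B (Dom B x)"
    using assms by (simp add: tup_Comp_eq_iff)
  then show "into_hom B C X Y x \<in> Mor B" "Dom B (into_hom B C X Y x) = Dom B x"
    "Cod B (into_hom B C X Y x) = homobj B C X Y" "homincl B C X Y \<cdot> into_hom B C X Y x = x"
    using assms by (simp_all add: into_hom_def homincl_def homobj_def)
qed

end

section \<open>Pre-geminal categories\<close>

locale pre_geminal_category =
  fixes B :: "('o, 'm) flcat" (structure) and C :: "('o, 'm) flicat"
    and F :: "('o, 'm, 'm, 'm) func" and H :: "'m ifunc"
  assumes is_pre_geminal: "pre_geminal B C F H"

sublocale pre_geminal_category \<subseteq> internal_finite_limit_category B C
  using is_pre_geminal by unfold_locales (simp_all add: pre_geminal_def)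

context pre_geminal_category
begin

section \<open>The functor \<open>F\<close> on objects, morphisms and limits\<close>

lemma functor_F: "is_functor B (Gamma B C) F"
  and limits_F: "strictly_preserves_finite_limits B (Gamma B C) F"
  using is_pre_geminal by (simp_all add: pre_geminal_def)

lemma FoF_simps [simp]:
  assumes "A \<in> Ob B"
  shows "Fo F A \<in> Mor B" "Dom B (Fo F A) = One B" "Cod B (Fo F A) = iObj C"
  using functor_F assms by (auto simp: is_functor_def Gamma_def in_hom_iff)

lemma FmF_simps [simp]:
  assumes "f \<in> Mor B"
  shows "Fm F f \<in> Mor B" "Dom B (Fm F f) = One B" "Cod B (Fm F f) = iMor C"
    "iDom C \<cdot> Fm F f = Fo F (Dom B f)" "iCod C \<cdot> Fm F f = Fo F (Cod B f)"
  using functor_F assms by (auto simp: is_functor_def Gamma_def in_hom_iff)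

lemma FmF_Comp:
  "f \<in> Mor B \<Longrightarrow> g \<in> Mor B \<Longrightarrow> Cod B f = Dom B g \<Longrightarrow> Fm F (g \<cdot> f) = icomp B C (Fm F g) (Fm F f)"
  using functor_F by (simp add: is_functor_def Gamma_def)

lemma FoF_One [simp]: "Fo F (One B) = iOne C"
  using limits_F by (simp add: strictly_preserves_finite_limits_def Gamma_def)

lemma FmF_Pb:
  assumes "f \<in> Mor B" "g \<in> Mor B" "Cod B f = Cod B g"
  shows "Fm F (Pb1 B f g) = pb1 (Fm F f) (Fm F g)" "Fm F (Pb2 B f g) = pb2 (Fm F f) (Fm F g)"
  using limits_F assms by (simp_all add: strictly_preserves_finite_limits_def Gamma_def)

lemma FmF_bang [simp]:
  assumes "f \<in> Mor B" "A \<in> Ob B"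
  shows "iDom C \<cdot> Fm F f \<cdot> bang B A = Fo F (Dom B f) \<cdot> bang B A"
    "iCod C \<cdot> Fm F f \<cdot> bang B A = Fo F (Cod B f) \<cdot> bang B A"
  using assms by (simp_all flip: Comp_assoc)

section \<open>The functor \<open>\<box>\<close> and its preservation of pullbacks\<close>

abbreviation "box_ob A \<equiv> homobj B C (iOne C) (Fo F A)"
text \<open>Monic by \<open>homincl_mono\<close>, so morphisms into \<open>\<box> A\<close> are
  compared as families of internal morphisms from \<open>iOne C\<close> to
  \<open>Fo F A\<close>.\<close>

abbreviation "incl A \<equiv> homincl B C (iOne C) (Fo F A)"
abbreviation "box_mor \<equiv> Fm (box B C F)"

lemma Fo_box: "Fo (box B C F) A = box_ob A"
  by (simp add: box_def func_comp_def global_section_def)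

lemma box_mor_eq:
  assumes "f \<in> Mor B"
  shows "box_mor f = into_hom B C (iOne C) (Fo F (Cod B f))
    (icomp B C (Fm F f \<cdot> bang B (box_ob (Dom B f))) (incl (Dom B f)))"
  using assms by (simp add: box_def func_comp_def global_section_def)

lemma box_mor_simps [simp]:
  assumes "f \<in> Mor B"
  shows "box_mor f \<in> Mor B" "Dom B (box_mor f) = box_ob (Dom B f)" "Cod B (box_mor f) = box_ob (Cod B f)"
  using assms by (simp_all add: box_mor_eq)

text \<open>Through \<open>incl\<close>, the morphism \<open>\<box> f\<close> acts on families by
  composition with the constant family at \<open>Fm F f\<close>.\<close>

lemma incl_box_mor:
  assumes "f \<in> Mor B" "x \<in> Mor B" "Cod B x = box_ob (Dom B f)"
  shows "incl (Cod B f) \<cdot> box_mor f \<cdot> x = icomp B C (Fm F f \<cdot> bang B (Dom B x)) (incl (Dom B f) \<cdot> x)"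
proof -
  have "incl (Cod B f) \<cdot> box_mor f = icomp B C (Fm F f \<cdot> bang B (box_ob (Dom B f))) (incl (Dom B f))"
    using assms(1) by (simp add: box_mor_eq)
  then have "(incl (Cod B f) \<cdot> box_mor f) \<cdot> x =
      icomp B C (Fm F f \<cdot> bang B (box_ob (Dom B f))) (incl (Dom B f)) \<cdot> x"
    by simp
  with assms show ?thesis by (simp add: icomp_Comp)
qed

text \<open>Through \<open>incl\<close>, functoriality of \<open>\<box>\<close> is associativity of
  internal composition together with functoriality of \<open>F\<close>.\<close>

lemma box_mor_Comp:
  assumes "f \<in> Mor B" "g \<in> Mor B" "Cod B f = Dom B g" "x \<in> Mor B" "Cod B x = box_ob (Dom B f)"
  shows "box_mor (g \<cdot> f) \<cdot> x = box_mor g \<cdot> box_mor f \<cdot> x"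
proof (rule homincl_mono[of "iOne C" "Fo F (Cod B g)"])
  have "incl (Cod B (g \<cdot> f)) \<cdot> box_mor (g \<cdot> f) \<cdot> x =
      icomp B C (icomp B C (Fm F g) (Fm F f) \<cdot> bang B (Dom B x)) (incl (Dom B f) \<cdot> x)"
    using assms incl_box_mor[of "g \<cdot> f" x] by (simp add: FmF_Comp)
  also have "\<dots> = icomp B C (icomp B C (Fm F g \<cdot> bang B (Dom B x)) (Fm F f \<cdot> bang B (Dom B x))) (incl (Dom B f) \<cdot> x)"
    using assms by (simp add: icomp_Comp)
  also have "\<dots> = icomp B C (Fm F g \<cdot> bang B (Dom B x)) (icomp B C (Fm F f \<cdot> bang B (Dom B x)) (incl (Dom B f) \<cdot> x))"
    by (rule icomp_assoc) (use assms in simp_all)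
  also have "\<dots> = incl (Cod B g) \<cdot> box_mor g \<cdot> box_mor f \<cdot> x"
    using assms incl_box_mor[of g "box_mor f \<cdot> x"] incl_box_mor[of f x] by simp
  finally show "incl (Cod B g) \<cdot> box_mor (g \<cdot> f) \<cdot> x = incl (Cod B g) \<cdot> box_mor g \<cdot> box_mor f \<cdot> x"
    using assms by simp
qed (use assms in simp_all)

text \<open>\<open>Fo F (One B)\<close> is \<open>iOne C\<close>, so both sides are families from
  \<open>iOne C\<close> to itself and internal terminality identifies them.\<close>

lemma box_One_unique:
  assumes "x \<in> Mor B" "y \<in> Mor B" "Dom B x = Dom B y" "Cod B x = box_ob (One B)" "Cod B y = box_ob (One B)"
  shows "x = y"
proof (rule homincl_mono[of "iOne C" "Fo F (One B)"])
  show "incl (One B) \<cdot> x = incl (One B) \<cdot> y"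
    by (rule to_iOne_unique) (use assms in simp_all)
qed (use assms in simp_all)

lemma pb_FmF_bang:
  assumes "f \<in> Mor B" "g \<in> Mor B" "Cod B f = Cod B g" "A \<in> Ob B"
  shows "pb1 (Fm F f \<cdot> bang B A) (Fm F g \<cdot> bang B A) = Fm F (Pb1 B f g) \<cdot> bang B A"
    "pb2 (Fm F f \<cdot> bang B A) (Fm F g \<cdot> bang B A) = Fm F (Pb2 B f g) \<cdot> bang B A"
  using assms by (simp_all add: FmF_Pb med_Comp)

text \<open>Uniqueness half of preservation of pullbacks. By \<open>pb_FmF_bang\<close> the internal
  pullback of the constant cospan is the constant family at the image of the chosen pullback, so
  \<open>pb_unique\<close> applies.\<close>

lemma box_Pb_joint_mono:
  assumes fg: "f \<in> Mor B" "g \<in> Mor B" "Cod B f = Cod B g"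
    and xy: "x \<in> Mor B" "y \<in> Mor B" "Dom B x = Dom B y"
    "Cod B x = box_ob (Dom B (Pb1 B f g))" "Cod B y = box_ob (Dom B (Pb1 B f g))"
    and eq: "box_mor (Pb1 B f g) \<cdot> x = box_mor (Pb1 B f g) \<cdot> y" "box_mor (Pb2 B f g) \<cdot> x = box_mor (Pb2 B f g) \<cdot> y"
  shows "x = y"
proof (rule homincl_mono[of "iOne C" "Fo F (Dom B (Pb1 B f g))"])
  let ?a = "Fm F f \<cdot> bang B (Dom B y)" and ?b = "Fm F g \<cdot> bang B (Dom B y)"
  let ?P = "Dom B (Pb1 B f g)"
  have e1: "icomp B C (Fm F (Pb1 B f g) \<cdot> bang B (Dom B y)) (incl ?P \<cdot> x) =
      icomp B C (Fm F (Pb1 B f g) \<cdot> bang B (Dom B y)) (incl ?P \<cdot> y)"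
    using incl_box_mor[of "Pb1 B f g" x] incl_box_mor[of "Pb1 B f g" y] fg xy eq(1) by simp
  have e2: "icomp B C (Fm F (Pb2 B f g) \<cdot> bang B (Dom B y)) (incl ?P \<cdot> x) =
      icomp B C (Fm F (Pb2 B f g) \<cdot> bang B (Dom B y)) (incl ?P \<cdot> y)"
    using incl_box_mor[of "Pb2 B f g" x] incl_box_mor[of "Pb2 B f g" y] fg xy eq(2) by simp
  show "incl ?P \<cdot> x = incl ?P \<cdot> y"
    by (rule pb_unique[of ?a ?b "incl ?P \<cdot> x" "incl ?P \<cdot> y"])
      (use fg xy e1 e2 in \<open>simp_all add: pb_FmF_bang\<close>)
qed (use fg xy in simp_all)

text \<open>Existence half. Through \<open>incl\<close> the cone is a family of commuting squares of
  \<open>C\<close>; the mediating family from \<open>pb_exists\<close> starts at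
  \<open>iOne C\<close> and so factors through the hom-object.\<close>

lemma box_Pb_exists:
  assumes fg: "f \<in> Mor B" "g \<in> Mor B" "Cod B f = Cod B g"
    and xy: "x \<in> Mor B" "y \<in> Mor B" "Dom B x = Dom B y"
    "Cod B x = box_ob (Dom B f)" "Cod B y = box_ob (Dom B g)"
    and eq: "box_mor f \<cdot> x = box_mor g \<cdot> y"
  shows "\<exists>z. z \<in> Mor B \<and> Dom B z = Dom B y \<and> Cod B z = box_ob (Dom B (Pb1 B f g)) \<and>
    box_mor (Pb1 B f g) \<cdot> z = x \<and> box_mor (Pb2 B f g) \<cdot> z = y"
proof -
  let ?a = "Fm F f \<cdot> bang B (Dom B y)" and ?b = "Fm F g \<cdot> bang B (Dom B y)"
  let ?u = "incl (Dom B f) \<cdot> x" and ?v = "incl (Dom B g) \<cdot> y"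
  let ?P = "Dom B (Pb1 B f g)"
  have e: "icomp B C ?a ?u = icomp B C ?b ?v"
    using incl_box_mor[of f x] incl_box_mor[of g y] fg xy eq by simp
  have "\<exists>m. m \<in> Mor B \<and> Cod B m = iMor C \<and> Dom B m = Dom B ?b \<and>
    iCod C \<cdot> m = iDom C \<cdot> pb1 ?a ?b \<and> iDom C \<cdot> m = iDom C \<cdot> ?u \<and>
    icomp B C (pb1 ?a ?b) m = ?u \<and> icomp B C (pb2 ?a ?b) m = ?v"
    by (rule pb_exists) (use fg xy e in simp_all)
  then obtain m where m: "m \<in> Mor B" "Cod B m = iMor C" "Dom B m = Dom B ?b"
    "iCod C \<cdot> m = iDom C \<cdot> pb1 ?a ?b" "iDom C \<cdot> m = iDom C \<cdot> ?u"
    "icomp B C (pb1 ?a ?b) m = ?u" "icomp B C (pb2 ?a ?b) m = ?v"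
    by blast
  have d: "Dom B m = Dom B y" using m(3) fg xy by simp
  have mm: "iCod C \<cdot> m = Fo F ?P \<cdot> bang B (Dom B y)" "iDom C \<cdot> m = iOne C \<cdot> bang B (Dom B y)"
    "icomp B C (Fm F (Pb1 B f g) \<cdot> bang B (Dom B y)) m = ?u"
    "icomp B C (Fm F (Pb2 B f g) \<cdot> bang B (Dom B y)) m = ?v"
    using m(4-) fg xy d by (simp_all add: pb_FmF_bang)
  let ?z = "into_hom B C (iOne C) (Fo F ?P) m"
  have z: "?z \<in> Mor B" "Dom B ?z = Dom B y" "Cod B ?z = box_ob ?P" "incl ?P \<cdot> ?z = m"
    using m(1,2) d mm fg xy by simp_all
  show ?thesis
  proof (intro exI[of _ ?z] conjI)
    show "box_mor (Pb1 B f g) \<cdot> ?z = x"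
      by (rule homincl_mono[of "iOne C" "Fo F (Dom B f)"])
        (use incl_box_mor[of "Pb1 B f g" ?z] z mm fg xy in simp_all)
    show "box_mor (Pb2 B f g) \<cdot> ?z = y"
      by (rule homincl_mono[of "iOne C" "Fo F (Dom B g)"])
        (use incl_box_mor[of "Pb2 B f g" ?z] z mm fg xy in simp_all)
  qed (use z in simp_all)
qed

abbreviation "elem f \<equiv> into_hom B C (iOne C) (Fo F (Cod B f)) (Fm F f)"

lemma elem_simps [simp]:
  assumes "f \<in> Mor B" "Dom B f = One B"
  shows "elem f \<in> Mor B" "Dom B (elem f) = One B" "Cod B (elem f) = box_ob (Cod B f)"
    "incl (Cod B f) \<cdot> elem f = Fm F f"
  using assms by simp_all

text \<open>Through \<open>incl\<close> both sides become the internal composite of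
  \<open>Fm F g\<close> with \<open>Fm F f\<close>.\<close>

lemma box_mor_elem:
  assumes "f \<in> Mor B" "Dom B f = One B" "g \<in> Mor B" "Cod B f = Dom B g"
  shows "box_mor g \<cdot> elem f = elem (g \<cdot> f)"
proof (rule homincl_mono[of "iOne C" "Fo F (Cod B g)"])
  show "incl (Cod B g) \<cdot> box_mor g \<cdot> elem f = incl (Cod B g) \<cdot> elem (g \<cdot> f)"
    using assms incl_box_mor[of g "elem f"] elem_simps[of f] elem_simps[of "g \<cdot> f"]
    by (simp add: FmF_Comp)
qed (use assms elem_simps[of f] elem_simps[of "g \<cdot> f"] in simp_all)

text \<open>\<open>elem f\<close> is the global element of \<open>\<box> (Cod f)\<close> named by \<open>F f\<close>, and \<open>pt\<close> that of \<open>\<box> 1\<close>.\<close>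

definition "pt = elem (Idn B (One B))"

lemma pt_simps [simp]: "pt \<in> Mor B" "Dom B pt = One B" "Cod B pt = box_ob (One B)"
  using elem_simps[of "Idn B (One B)"] by (simp_all add: pt_def)

lemma box_mor_pt: "g \<in> Mor B \<Longrightarrow> Dom B g = One B \<Longrightarrow> box_mor g \<cdot> pt = elem g"
  using box_mor_elem[of "Idn B (One B)" g] by (simp add: pt_def)

section \<open>The internal functor \<open>H\<close> and its restriction to objects of codes\<close>

lemma H_simps [simp]:
  "hObj H \<in> Mor B" "Dom B (hObj H) = iObj C" "Cod B (hObj H) = box_ob (iObj C)"
  "hMor H \<in> Mor B" "Dom B (hMor H) = iMor C" "Cod B (hMor H) = box_ob (iMor C)"
  and H_iDom: "box_mor (iDom C) \<cdot> hMor H = hObj H \<cdot> iDom C"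
  and H_iCod: "box_mor (iCod C) \<cdot> hMor H = hObj H \<cdot> iCod C"
  using is_pre_geminal
  by (auto simp: pre_geminal_def internal_functor_def image_icat_def Let_def in_hom_iff Fo_box)

text \<open>As \<open>F\<close> preserves the terminal object strictly, the canonical isomorphism in \<^const>\<open>sharp\<close> is an
  identity.\<close>

lemma sharp_unit:
  "(THE m. m \<in> hom (Gamma B C) (One (Gamma B C)) (iOne C)) = iId C \<cdot> iOne C"
proof (rule the_equality)
  show "iId C \<cdot> iOne C \<in> hom (Gamma B C) (One (Gamma B C)) (iOne C)"
    by (simp add: Gamma_def in_hom_iff)
  fix m assume "m \<in> hom (Gamma B C) (One (Gamma B C)) (iOne C)"
  then show "m = iId C \<cdot> iOne C"
    using to_iOne_unique[of m "iId C \<cdot> iOne C"] by (simp add: Gamma_def in_hom_iff)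
qed

text \<open>The two components of the compatibility equation. The functor \<open>sharp\<close>
  composes \<open>Fm F x\<close> with the identity of \<open>iOne C\<close>, which the unit law
  removes, and \<open>canonical_iso\<close> turns the result into an element of the
  hom-object.\<close>

lemma
  shows H_Fo: "A \<in> Ob B \<Longrightarrow> hObj H \<cdot> Fo F A = elem (Fo F A)"
    and H_Fm: "f \<in> Mor B \<Longrightarrow> hMor H \<cdot> Fm F f = elem (Fm F f)"
proof -
  have eq: "func_eq_on B (func_comp (Gamma_func B H) F)
      (func_comp (canonical_iso B C) (func_comp (sharp B (Gamma B C) F) F))"
    using is_pre_geminal by (simp add: pre_geminal_def)
  have unit: "icomp B C (Fm F x) (iId C \<cdot> iOne C) = Fm F x" if "x \<in> Mor B" "Dom B x = One B" for x
    using icomp_id_right[of "Fm F x"] that by simp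
  have G: "Comp (Gamma B C) = icomp B C" by (simp add: Gamma_def)
  show "hObj H \<cdot> Fo F A = elem (Fo F A)" if "A \<in> Ob B"
    using eq that
    by (simp add: func_eq_on_def func_comp_def Gamma_func_def canonical_iso_def sharp_def Let_def sharp_unit G unit)
  show "hMor H \<cdot> Fm F f = elem (Fm F f)" if "f \<in> Mor B"
    using eq that
    by (simp add: func_eq_on_def func_comp_def Gamma_func_def canonical_iso_def sharp_def Let_def sharp_unit G unit)
qed

text \<open>Common form of both kinds of object of codes: \<open>i\<close> is a pullback of
  \<open>f\<close> along a global element \<open>g\<close>. As \<open>\<box>\<close> preserves it,
  factoring \<open>hMor H \<cdot> i\<close> through \<open>\<box> i\<close> only requires the cone
  condition \<open>H\<close>.\<close>

lemma restrict_H: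
  fixes f g
  defines "i \<equiv> Pb1 B f g"
  assumes f: "f \<in> Mor B" "Dom B f = iMor C" and g: "g \<in> Mor B" "Dom B g = One B" "Cod B f = Cod B g"
    and H: "box_mor f \<cdot> hMor H \<cdot> i = box_mor g \<cdot> pt \<cdot> bang B (Dom B i)"
  shows "restrict_H B C F H i \<in> hom B (Dom B i) (box_ob (Dom B i))"
    and "\<And>x h. x \<in> Mor B \<Longrightarrow> Dom B x = One B \<Longrightarrow> Cod B x = Dom B i \<Longrightarrow> h \<in> Mor B \<Longrightarrow> i \<cdot> x = Fm F h \<Longrightarrow>
      restrict_H B C F H i \<cdot> x = elem x"
proof -
  have i: "i \<in> Mor B" "Cod B i = iMor C" using f g by (simp_all add: i_def)
  have mono: "x = y" if "x \<in> Mor B" "y \<in> Mor B" "Dom B x = Dom B y" "Cod B x = box_ob (Dom B i)"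
    "Cod B y = box_ob (Dom B i)" "box_mor i \<cdot> x = box_mor i \<cdot> y" for x y
  proof (rule box_Pb_joint_mono[of f g])
    \<comment> \<open>The other projection is sent into \<open>\<box> 1\<close>, where parallel
      morphisms agree. Hence \<open>\<box> i\<close> is monic, which gives uniqueness in
      \<open>restrict_H\<close>.\<close>
    show "box_mor (Pb2 B f g) \<cdot> x = box_mor (Pb2 B f g) \<cdot> y"
      by (rule box_One_unique) (use that f g in \<open>simp_all add: i_def\<close>)
  qed (use that f g in \<open>simp_all add: i_def\<close>)
  obtain z where z: "z \<in> Mor B" "Dom B z = Dom B i" "Cod B z = box_ob (Dom B i)"
    "box_mor i \<cdot> z = hMor H \<cdot> i"
    using box_Pb_exists[of f g "hMor H \<cdot> i" "pt \<cdot> bang B (Dom B i)", folded i_def] f g i H by auto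
  have r: "restrict_H B C F H i = z"
    unfolding restrict_H_def
  proof (rule the_equality)
    fix m assume "m \<in> hom B (Dom B i) (Fo (box B C F) (Dom B i)) \<and> box_mor i \<cdot> m = hMor H \<cdot> i"
    then have "m \<in> Mor B" "Dom B m = Dom B i" "Cod B m = box_ob (Dom B i)" "box_mor i \<cdot> m = hMor H \<cdot> i"
      by (simp_all add: in_hom_iff Fo_box)
    with z show "m = z" using mono[of m z] by simp
  qed (use z in \<open>simp add: in_hom_iff Fo_box\<close>)
  show "restrict_H B C F H i \<in> hom B (Dom B i) (box_ob (Dom B i))"
    using z by (simp add: r in_hom_iff)
  fix x h assume x: "x \<in> Mor B" "Dom B x = One B" "Cod B x = Dom B i" and h: "h \<in> Mor B" "i \<cdot> x = Fm F h"
  \<comment> \<open>Both candidates agree after \<open>\<box> i\<close>: on one side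
    \<open>H\<close> sends \<open>Fm F h\<close> to its named element, on the other
    \<open>\<box> i\<close> acts on named elements by composition.\<close>
  have "box_mor i \<cdot> z \<cdot> x = hMor H \<cdot> i \<cdot> x"
    by (rule Comp_cong_assoc) (use z x i in simp_all)
  also have "\<dots> = elem (i \<cdot> x)" using h by (simp add: H_Fm)
  also have "\<dots> = box_mor i \<cdot> elem x" using x i box_mor_elem[of x i] by simp
  finally have "box_mor i \<cdot> z \<cdot> x = box_mor i \<cdot> elem x" .
  then have "z \<cdot> x = elem x"
    using x z i elem_simps[OF x(1,2)] mono[of "z \<cdot> x" "elem x"] by simp
  then show "restrict_H B C F H i \<cdot> x = elem x" by (simp add: r)
qed

lemma elem_Fo_bang:
  assumes "A \<in> Ob B" "I \<in> Ob B"
  shows "box_mor (Fo F A) \<cdot> pt \<cdot> bang B I = hObj H \<cdot> Fo F A \<cdot> bang B I"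
proof -
  have "box_mor (Fo F A) \<cdot> pt = hObj H \<cdot> Fo F A"
    using assms by (simp add: H_Fo box_mor_pt)
  from Comp_cong_assoc[OF this] show ?thesis using assms by simp
qed

text \<open>Morphisms into \<open>\<box>\<close> of the product of \<open>iObj C\<close> with itself
  are determined by their projections, so the cone condition is checked after each one. There it
  follows because \<open>H\<close> commutes with domain and codomain and has known values at
  \<open>Fo F A\<close> and \<open>Fo F A'\<close>.\<close>

lemma restrict_H_homincl:
  assumes "A \<in> Ob B" "A' \<in> Ob B"
  defines "i \<equiv> homincl B C (Fo F A) (Fo F A')"
  shows "restrict_H B C F H i \<in> hom B (Dom B i) (box_ob (Dom B i))"
    and "\<And>x h. x \<in> Mor B \<Longrightarrow> Dom B x = One B \<Longrightarrow> Cod B x = Dom B i \<Longrightarrow> h \<in> Mor B \<Longrightarrow> i \<cdot> x = Fm F h \<Longrightarrow>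
      restrict_H B C F H i \<cdot> x = elem x"
proof -
  let ?f = "tup B (iDom C) (iCod C)" and ?g = "tup B (Fo F A) (Fo F A')"
  let ?y = "pt \<cdot> bang B (Dom B i)"
  have y: "?y \<in> Mor B" "Dom B ?y = Dom B i" "Cod B ?y = box_ob (One B)"
    using assms by simp_all
  have i: "i \<in> Mor B" "Cod B i = iMor C" "iDom C \<cdot> i = Fo F A \<cdot> bang B (Dom B i)"
    "iCod C \<cdot> i = Fo F A' \<cdot> bang B (Dom B i)" "i = Pb1 B ?f ?g"
    using assms by (simp_all flip: homincl_def)
  have pr: "box_mor (Pr1 B (iObj C) (iObj C)) \<cdot> box_mor (tup B u v) \<cdot> w = box_mor u \<cdot> w"
    "box_mor (Pr2 B (iObj C) (iObj C)) \<cdot> box_mor (tup B u v) \<cdot> w = box_mor v \<cdot> w"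
    if "u \<in> Mor B" "v \<in> Mor B" "Dom B u = Dom B v" "Cod B u = iObj C" "Cod B v = iObj C"
      "w \<in> Mor B" "Cod B w = box_ob (Dom B u)" for u v w
    using that box_mor_Comp[of "tup B u v" "Pr1 B (iObj C) (iObj C)" w]
      box_mor_Comp[of "tup B u v" "Pr2 B (iObj C) (iObj C)" w] tup_simps(4,5)[of u v]
    by simp_all
  have H: "box_mor ?f \<cdot> hMor H \<cdot> i = box_mor ?g \<cdot> ?y"
  proof (rule box_Pb_joint_mono[of "bang B (iObj C)" "bang B (iObj C)", folded Pr1_def Pr2_def])
    have "box_mor (iDom C) \<cdot> hMor H \<cdot> i = hObj H \<cdot> iDom C \<cdot> i"
      by (rule Comp_cong_assoc) (use i(1,2) H_iDom in simp_all)
    also have "\<dots> = box_mor (Fo F A) \<cdot> ?y" using assms(1,2) i(1-4) by (simp add: elem_Fo_bang)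
    finally show "box_mor (Pr1 B (iObj C) (iObj C)) \<cdot> box_mor ?f \<cdot> hMor H \<cdot> i =
        box_mor (Pr1 B (iObj C) (iObj C)) \<cdot> box_mor ?g \<cdot> ?y"
      using assms(1,2) i(1,2) y pr[of "iDom C" "iCod C" "hMor H \<cdot> i"] pr[of "Fo F A" "Fo F A'" ?y] by simp
    have "box_mor (iCod C) \<cdot> hMor H \<cdot> i = hObj H \<cdot> iCod C \<cdot> i"
      by (rule Comp_cong_assoc) (use i(1,2) H_iCod in simp_all)
    also have "\<dots> = box_mor (Fo F A') \<cdot> ?y" using assms(1,2) i(1-4) by (simp add: elem_Fo_bang)
    finally show "box_mor (Pr2 B (iObj C) (iObj C)) \<cdot> box_mor ?f \<cdot> hMor H \<cdot> i =
        box_mor (Pr2 B (iObj C) (iObj C)) \<cdot> box_mor ?g \<cdot> ?y"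
      using assms(1,2) i(1,2) y pr[of "iDom C" "iCod C" "hMor H \<cdot> i"] pr[of "Fo F A" "Fo F A'" ?y] by simp
  qed (use assms(1,2) i(1,2) y in simp_all)
  show "restrict_H B C F H i \<in> hom B (Dom B i) (box_ob (Dom B i))"
    "\<And>x h. x \<in> Mor B \<Longrightarrow> Dom B x = One B \<Longrightarrow> Cod B x = Dom B i \<Longrightarrow> h \<in> Mor B \<Longrightarrow> i \<cdot> x = Fm F h \<Longrightarrow>
      restrict_H B C F H i \<cdot> x = elem x"
    using restrict_H[of ?f ?g, folded i(5)] H assms(1,2) by simp_all
qed

text \<open>The cone condition follows from \<open>H\<close> commuting with codomains and its value
  at \<open>Fo F A\<close>.\<close>

lemma restrict_H_Pb1:
  assumes "A \<in> Ob B"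
  defines "i \<equiv> Pb1 B (iCod C) (Fo F A)"
  shows "restrict_H B C F H i \<in> hom B (Dom B i) (box_ob (Dom B i))"
    and "\<And>x h. x \<in> Mor B \<Longrightarrow> Dom B x = One B \<Longrightarrow> Cod B x = Dom B i \<Longrightarrow> h \<in> Mor B \<Longrightarrow> i \<cdot> x = Fm F h \<Longrightarrow>
      restrict_H B C F H i \<cdot> x = elem x"
proof -
  have i: "i \<in> Mor B" "Cod B i = iMor C" using assms by simp_all
  have q: "Pb2 B (iCod C) (Fo F A) = bang B (Dom B i)"
    using assms eq_bang[of "Pb2 B (iCod C) (Fo F A)"] by simp
  have "box_mor (iCod C) \<cdot> hMor H \<cdot> i = hObj H \<cdot> iCod C \<cdot> i"
    by (rule Comp_cong_assoc) (use i H_iCod in simp_all)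
  also have "iCod C \<cdot> i = Fo F A \<cdot> Pb2 B (iCod C) (Fo F A)"
    unfolding i_def by (rule Pb_comm) (use assms in simp_all)
  also have "\<dots> = Fo F A \<cdot> bang B (Dom B i)" by (simp only: q)
  also have "hObj H \<cdot> \<dots> = box_mor (Fo F A) \<cdot> pt \<cdot> bang B (Dom B i)"
    using assms(1) i by (simp add: elem_Fo_bang)
  finally show "restrict_H B C F H i \<in> hom B (Dom B i) (box_ob (Dom B i))"
    "\<And>x h. x \<in> Mor B \<Longrightarrow> Dom B x = One B \<Longrightarrow> Cod B x = Dom B i \<Longrightarrow> h \<in> Mor B \<Longrightarrow> i \<cdot> x = Fm F h \<Longrightarrow>
      restrict_H B C F H i \<cdot> x = elem x"
    using restrict_H[of "iCod C" "Fo F A", folded i_def] assms(1) by simp_all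
qed

section \<open>The induced code structures\<close>

lemma hom_code_simps:
  assumes "f \<in> Mor B"
  shows "hom_code B C F (Dom B f) (Cod B f) f \<in> Mor B"
    "Dom B (hom_code B C F (Dom B f) (Cod B f) f) = One B"
    "Cod B (hom_code B C F (Dom B f) (Cod B f) f) = homobj B C (Fo F (Dom B f)) (Fo F (Cod B f))"
    "homincl B C (Fo F (Dom B f)) (Fo F (Cod B f)) \<cdot> hom_code B C F (Dom B f) (Cod B f) f = Fm F f"
  using assms by (simp_all add: hom_code_def)

text \<open>As \<open>F\<close> sends \<open>One B\<close> to \<open>iOne C\<close>, the code of a
  global element is its named element in \<open>\<box>\<close>. This matches the two sides of the
  \<open>Code\<close> condition.\<close>

lemma hom_code_One: "hom_code B C F (One B) (Cod B x) x = elem x"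
  by (simp add: hom_code_def)

text \<open>The \<open>App\<close> condition is checked after the monic \<open>homincl\<close>,
  where it becomes functoriality of \<open>F\<close>. The \<open>Code\<close> condition is the value
  of the restricted \<open>H\<close> at the code of \<open>X\<close>, which lies over
  \<open>Fm F X\<close>.\<close>

lemma code_structure_dom:
  assumes D: "D \<in> Ob B"
  shows "code_structure B (Pr1 B) (Pr2 B) (dom_fibration B D) (dom_codes B C F H D)"
proof -
  let ?p = "dom_fibration B D"
  let ?hob = "\<lambda>A A'. homobj B C (Fo F A) (Fo F A')" and ?hin = "\<lambda>A A'. homincl B C (Fo F A) (Fo F A')"
  have fib: "X \<in> Ob (fiber B ?p A) \<longleftrightarrow> X \<in> Mor B \<and> Dom B X = A \<and> Cod B X = D" for X A
    by (auto simp: fiber_def dom_fibration_simps slice_simps)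
  have re: "Fo (reindex B ?p f) X = X \<cdot> f" for f X
    by (simp add: reindex_def dom_fibration_simps slice_simps)
  note cf = cloven_fibration_dom[OF D]
  show ?thesis
    unfolding code_structure_def tup_def[symmetric]
  proof (intro conjI ballI cf terminal_One has_products_Pr)
    fix A assume A: "A \<in> Ob B"
    show "EO (dom_codes B C F H D) A \<in> Ob B" using A D by (simp add: dom_codes_def Let_def)
    show "EC (dom_codes B C F H D) A X \<in> hom B (One B) (EO (dom_codes B C F H D) A)"
      if "X \<in> Ob (fiber B ?p A)" for X
      using that hom_code_simps[of X] by (auto simp: dom_codes_def Let_def fib in_hom_iff)
    show "Code (dom_codes B C F H D) A \<in> hom B (EO (dom_codes B C F H D) A)
        (HO (dom_codes B C F H D) (One B) (EO (dom_codes B C F H D) A))"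
      using restrict_H_homincl(1)[OF A D] A D by (simp add: dom_codes_def Let_def)
    show "approx B (Pr1 B) (Pr2 B) ?p (Code (dom_codes B C F H D) A \<cdot> EC (dom_codes B C F H D) A X)
        (HC (dom_codes B C F H D) (One B) (EO (dom_codes B C F H D) A) (EC (dom_codes B C F H D) A X))"
      if "X \<in> Ob (fiber B ?p A)" for X
    proof -
      let ?c = "hom_code B C F A D X"
      have X: "X \<in> Mor B" "Dom B X = A" "Cod B X = D" using that by (simp_all add: fib)
      have c: "?c \<in> Mor B" "Dom B ?c = One B" "Cod B ?c = ?hob A D" "?hin A D \<cdot> ?c = Fm F X"
        using hom_code_simps[OF X(1)] X by auto
      have "restrict_H B C F H (?hin A D) \<cdot> ?c = hom_code B C F (One B) (?hob A D) ?c"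
        using restrict_H_homincl(2)[OF A D c(1,2) _ X(1) c(4)] A D c hom_code_One[of ?c] by simp
      moreover have "hom_code B C F (One B) (?hob A D) ?c \<in> Mor B"
        using hom_code_simps(1)[OF c(1)] c by simp
      ultimately show ?thesis
        using approx_refl[OF cf] by (simp add: dom_codes_def Let_def)
    qed
  next
    fix A A' assume A: "A \<in> Ob B" "A' \<in> Ob B"
    show "HO (dom_codes B C F H D) A A' \<in> Ob B" using A by (simp add: dom_codes_def Let_def)
    show "HC (dom_codes B C F H D) A A' f \<in> hom B (One B) (HO (dom_codes B C F H D) A A')"
      if "f \<in> hom B A A'" for f
      using that hom_code_simps[of f] by (auto simp: dom_codes_def Let_def in_hom_iff)
    let ?g = "?hin A' D \<cdot> Pr1 B (?hob A' D) (?hob A A')" and ?f = "?hin A A' \<cdot> Pr2 B (?hob A' D) (?hob A A')"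
    let ?app = "into_hom B C (Fo F A) (Fo F D) (icomp B C ?g ?f)"
    have gf: "icomp B C ?g ?f \<in> Mor B" "Cod B (icomp B C ?g ?f) = iMor C"
      "Dom B (icomp B C ?g ?f) = Dom B (Pr1 B (?hob A' D) (?hob A A'))"
      "iDom C \<cdot> icomp B C ?g ?f = Fo F A \<cdot> bang B (Dom B (icomp B C ?g ?f))"
      "iCod C \<cdot> icomp B C ?g ?f = Fo F D \<cdot> bang B (Dom B (icomp B C ?g ?f))"
      using A D by simp_all
    have app: "?app \<in> Mor B" "Dom B ?app = Dom B (Pr1 B (?hob A' D) (?hob A A'))" "Cod B ?app = ?hob A D"
      "?hin A D \<cdot> ?app = icomp B C ?g ?f"
      using into_hom_simps[of "Fo F A" "Fo F D", OF _ _ _ _ _ _ gf(1,2,4,5)] gf(3) A D by simp_all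
    show "App (dom_codes B C F H D) A A' \<in> hom B
        (Dom B (Pr1 B (EO (dom_codes B C F H D) A') (HO (dom_codes B C F H D) A A')))
        (EO (dom_codes B C F H D) A)"
      using app by (simp add: dom_codes_def Let_def in_hom_iff)
    fix X f assume "X \<in> Ob (fiber B ?p A')" "f \<in> hom B A A'"
    then have X: "X \<in> Mor B" "Dom B X = A'" "Cod B X = D" and f: "f \<in> Mor B" "Dom B f = A" "Cod B f = A'"
      by (simp_all add: fib in_hom_iff)
    let ?x = "hom_code B C F A' D X" and ?c = "hom_code B C F A A' f"
    have x: "?x \<in> Mor B" "Dom B ?x = One B" "Cod B ?x = ?hob A' D" "?hin A' D \<cdot> ?x = Fm F X"
      using hom_code_simps[OF X(1)] X by auto
    have c: "?c \<in> Mor B" "Dom B ?c = One B" "Cod B ?c = ?hob A A'" "?hin A A' \<cdot> ?c = Fm F f"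
      using hom_code_simps[OF f(1)] f by auto
    have t: "tup B ?x ?c \<in> Mor B" "Dom B (tup B ?x ?c) = One B"
      "Cod B (tup B ?x ?c) = Dom B (Pr1 B (?hob A' D) (?hob A A'))"
      "Pr1 B (?hob A' D) (?hob A A') \<cdot> tup B ?x ?c = ?x" "Pr2 B (?hob A' D) (?hob A A') \<cdot> tup B ?x ?c = ?c"
      using tup_simps[of ?x ?c] x c by simp_all
    have Xf: "X \<cdot> f \<in> Mor B" "Dom B (X \<cdot> f) = A" "Cod B (X \<cdot> f) = D" using X f by simp_all
    have xf: "hom_code B C F A D (X \<cdot> f) \<in> Mor B" "Cod B (hom_code B C F A D (X \<cdot> f)) = ?hob A D"
      "?hin A D \<cdot> hom_code B C F A D (X \<cdot> f) = Fm F (X \<cdot> f)"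
      using hom_code_simps[OF Xf(1)] unfolding Xf(2,3) by auto
    have "?app \<cdot> tup B ?x ?c = hom_code B C F A D (X \<cdot> f)"
    proof (rule homincl_mono[of "Fo F A" "Fo F D"])
      have "?hin A D \<cdot> ?app \<cdot> tup B ?x ?c = (?hin A D \<cdot> ?app) \<cdot> tup B ?x ?c"
        by (rule Comp_assoc[symmetric]) (use t app A D in simp_all)
      also have "\<dots> = icomp B C (?g \<cdot> tup B ?x ?c) (?f \<cdot> tup B ?x ?c)"
        unfolding app(4) by (rule icomp_Comp) (use t A D in simp_all)
      also have "\<dots> = Fm F (X \<cdot> f)"
        using t x c X f A D by (simp add: FmF_Comp)
      finally show "?hin A D \<cdot> ?app \<cdot> tup B ?x ?c = ?hin A D \<cdot> hom_code B C F A D (X \<cdot> f)"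
        by (simp only: xf)
    qed (use t app xf A D in simp_all)
    then show "approx B (Pr1 B) (Pr2 B) ?p
        (App (dom_codes B C F H D) A A' \<cdot> tup B (EC (dom_codes B C F H D) A' X) (HC (dom_codes B C F H D) A A' f))
        (EC (dom_codes B C F H D) A (Fo (reindex B ?p f) X))"
      using approx_refl[OF cf xf(1)] by (simp add: dom_codes_def Let_def re)
  qed
qed

text \<open>As in the representable case, with strict preservation of pullbacks in place of
  functoriality of \<open>F\<close> in the \<open>App\<close> condition, since reindexing sends
  \<open>X\<close> to \<open>Pb2 B X f\<close>.\<close>

lemma code_structure_cod:
  "code_structure B (Pr1 B) (Pr2 B) (cod_fibration B) (cod_codes B C F H)"
proof -
  let ?p = "cod_fibration B" and ?S = "cod_codes B C F H"
  let ?hob = "\<lambda>A A'. homobj B C (Fo F A) (Fo F A')" and ?hin = "\<lambda>A A'. homincl B C (Fo F A) (Fo F A')"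
  let ?sin = "\<lambda>A. Pb1 B (iCod C) (Fo F A)"
  let ?sob = "\<lambda>A. Dom B (?sin A)"
  let ?into = "\<lambda>A f. med B (iCod C) (Fo F A) f (bang B (Dom B f))"
  have fib: "X \<in> Ob (fiber B ?p A) \<longleftrightarrow> X \<in> Mor B \<and> Cod B X = A" for X A
    by (auto simp: fiber_def cod_fibration_def arrow_cat_def)
  have re: "Fo (reindex B ?p f) X = Pb2 B X f" for f X
    by (simp add: reindex_def cod_fibration_def arrow_cat_def)
  have S: "EO ?S = ?sob" "EC ?S = (\<lambda>A X. ?into A (Fm F X))" "HO ?S = ?hob" "HC ?S = hom_code B C F"
    "App ?S A A' = ?into A (iPb2 C \<cdot> med B (iCod C) (iCod C)
                  (?sin A' \<cdot> Pr1 B (?sob A') (?hob A A')) (?hin A A' \<cdot> Pr2 B (?sob A') (?hob A A')))"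
    "Code ?S A = restrict_H B C F H (?sin A)" for A A'
    by (simp_all add: cod_codes_def Let_def)
  have into: "?into A f \<in> Mor B" "Dom B (?into A f) = Dom B f" "Cod B (?into A f) = ?sob A" "?sin A \<cdot> ?into A f = f"
    if "A \<in> Ob B" "f \<in> Mor B" "Cod B f = iMor C" "iCod C \<cdot> f = Fo F A \<cdot> bang B (Dom B f)" for A f
    using that by simp_all
  have code: "?into (Cod B X) (Fm F X) \<in> Mor B" "Dom B (?into (Cod B X) (Fm F X)) = One B"
    "Cod B (?into (Cod B X) (Fm F X)) = ?sob (Cod B X)" "?sin (Cod B X) \<cdot> ?into (Cod B X) (Fm F X) = Fm F X"
    if "X \<in> Mor B" for X
    using that by simp_all
  note cf = cloven_fibration_cod
  show ?thesis
    unfolding code_structure_def tup_def[symmetric] S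
  proof (intro conjI ballI cf terminal_One has_products_Pr)
    fix A assume A: "A \<in> Ob B"
    show "?sob A \<in> Ob B" using A by simp
    show "?into A (Fm F X) \<in> hom B (One B) (?sob A)" if "X \<in> Ob (fiber B ?p A)" for X
      using that code[of X] by (auto simp: fib in_hom_iff)
    show "restrict_H B C F H (?sin A) \<in> hom B (?sob A) (?hob (One B) (?sob A))"
      using restrict_H_Pb1(1)[OF A] by simp
    show "approx B (Pr1 B) (Pr2 B) ?p (restrict_H B C F H (?sin A) \<cdot> ?into A (Fm F X))
        (hom_code B C F (One B) (?sob A) (?into A (Fm F X)))"
      if "X \<in> Ob (fiber B ?p A)" for X
    proof -
      let ?c = "?into A (Fm F X)"
      have X: "X \<in> Mor B" "Cod B X = A" using that by (simp_all add: fib)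
      have c: "?c \<in> Mor B" "Dom B ?c = One B" "Cod B ?c = ?sob A" "?sin A \<cdot> ?c = Fm F X"
        using code[OF X(1)] unfolding X by auto
      have "restrict_H B C F H (?sin A) \<cdot> ?c = hom_code B C F (One B) (?sob A) ?c"
        using restrict_H_Pb1(2)[OF A c(1-3) X(1) c(4)] c(3) hom_code_One[of ?c] by simp
      moreover have "hom_code B C F (One B) (?sob A) ?c \<in> Mor B"
        using hom_code_simps(1)[OF c(1)] unfolding c(2,3) .
      ultimately show ?thesis
        using approx_refl[OF cf] by simp
    qed
  next
    fix A A' assume A: "A \<in> Ob B" "A' \<in> Ob B"
    show "?hob A A' \<in> Ob B" using A by simp
    show "hom_code B C F A A' f \<in> hom B (One B) (?hob A A')" if "f \<in> hom B A A'" for f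
      using that hom_code_simps[of f] by (auto simp: in_hom_iff)
    let ?a = "?sin A' \<cdot> Pr1 B (?sob A') (?hob A A')" and ?b = "?hin A A' \<cdot> Pr2 B (?sob A') (?hob A A')"
    let ?P = "Dom B (Pr1 B (?sob A') (?hob A A'))"
    let ?app = "?into A (pb2 ?a ?b)"
    \<comment> \<open>The second projection of the pullback is a \<open>bang\<close>, so the generic
      internal morphism into \<open>Fo F A'\<close> has constant codomain. This makes
      \<open>?a\<close> and \<open>?b\<close> a cospan.\<close>
    have sin: "iCod C \<cdot> ?sin A' = Fo F A' \<cdot> bang B (?sob A')"
      using A Pb_comm[of "iCod C" "Fo F A'"] eq_bang[of "Pb2 B (iCod C) (Fo F A')"] by simp
    have "iCod C \<cdot> ?a = Fo F A' \<cdot> bang B (?sob A') \<cdot> Pr1 B (?sob A') (?hob A A')"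
      by (rule Comp_cong_assoc) (use A sin in simp_all)
    also have "\<dots> = Fo F A' \<cdot> bang B ?P" using A by simp
    also have "\<dots> = iCod C \<cdot> ?b" using A by simp
    finally have ab: "?a \<in> Mor B" "?b \<in> Mor B" "Cod B ?a = iMor C" "Cod B ?b = iMor C" "Dom B ?a = ?P" "Dom B ?b = ?P"
      "iCod C \<cdot> ?a = iCod C \<cdot> ?b"
      using A by simp_all
    have pb: "pb2 ?a ?b \<in> Mor B" "Cod B (pb2 ?a ?b) = iMor C" "Dom B (pb2 ?a ?b) = ?P"
      "iCod C \<cdot> pb2 ?a ?b = Fo F A \<cdot> bang B (Dom B (pb2 ?a ?b))"
      using ab pb_simps(2)[OF ab(1-4) _ ab(7)] A by simp_all
    have app: "?app \<in> Mor B" "Dom B ?app = ?P" "Cod B ?app = ?sob A" "?sin A \<cdot> ?app = pb2 ?a ?b"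
      using into[OF A(1) pb(1,2,4)] pb(3) by simp_all
    show "?app \<in> hom B ?P (?sob A)" using app by (simp add: in_hom_iff)
    fix X f assume "X \<in> Ob (fiber B ?p A')" "f \<in> hom B A A'"
    then have X: "X \<in> Mor B" "Cod B X = A'" and f: "f \<in> Mor B" "Dom B f = A" "Cod B f = A'"
      by (simp_all add: fib in_hom_iff)
    let ?x = "?into A' (Fm F X)" and ?c = "hom_code B C F A A' f"
    have x: "?x \<in> Mor B" "Dom B ?x = One B" "Cod B ?x = ?sob A'" "?sin A' \<cdot> ?x = Fm F X"
      using code[OF X(1)] unfolding X(2) by auto
    have c: "?c \<in> Mor B" "Dom B ?c = One B" "Cod B ?c = ?hob A A'" "?hin A A' \<cdot> ?c = Fm F f"
      using hom_code_simps[OF f(1)] unfolding f by auto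
    have t: "tup B ?x ?c \<in> Mor B" "Dom B (tup B ?x ?c) = One B"
      "Cod B (tup B ?x ?c) = ?P"
      "Pr1 B (?sob A') (?hob A A') \<cdot> tup B ?x ?c = ?x" "Pr2 B (?sob A') (?hob A A') \<cdot> tup B ?x ?c = ?c"
      using tup_simps[OF x(1) c(1)] unfolding x(2,3) c(2,3) by simp_all
    have y: "Pb2 B X f \<in> Mor B" "Cod B (Pb2 B X f) = A" using X f by simp_all
    let ?y = "?into A (Fm F (Pb2 B X f))"
    have yc: "?y \<in> Mor B" "Dom B ?y = One B" "Cod B ?y = ?sob A" "?sin A \<cdot> ?y = Fm F (Pb2 B X f)"
      using code[OF y(1)] unfolding y(2) by auto
    have eq: "?app \<cdot> tup B ?x ?c = ?y"
    proof (rule Pb_joint_mono[of "iCod C" "Fo F A"])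
      have "?sin A \<cdot> ?app \<cdot> tup B ?x ?c = (?sin A \<cdot> ?app) \<cdot> tup B ?x ?c"
        by (rule Comp_assoc[symmetric]) (use t(1-3) app(1-3) A in simp_all)
      also have "\<dots> = pb2 ?a ?b \<cdot> tup B ?x ?c" by (simp only: app)
      also have "\<dots> = iPb2 C \<cdot> med B (iCod C) (iCod C) ?a ?b \<cdot> tup B ?x ?c"
        by (rule Comp_assoc) (use ab t(1-3) in simp_all)
      also have "\<dots> = pb2 (?a \<cdot> tup B ?x ?c) (?b \<cdot> tup B ?x ?c)"
        by (subst med_Comp) (use ab t(1-3) in simp_all)
      also have "?a \<cdot> tup B ?x ?c = Fm F X"
        using A t x(4) by (simp del: med_simps)
      also have "?b \<cdot> tup B ?x ?c = Fm F f"
        using A t c(4) by (simp del: med_simps)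
      also have "pb2 (Fm F X) (Fm F f) = Fm F (Pb2 B X f)"
        using X f by (simp add: FmF_Pb)
      finally show "?sin A \<cdot> ?app \<cdot> tup B ?x ?c = ?sin A \<cdot> ?y" by (simp only: yc)
      show "Pb2 B (iCod C) (Fo F A) \<cdot> ?app \<cdot> tup B ?x ?c = Pb2 B (iCod C) (Fo F A) \<cdot> ?y"
        by (rule to_One_unique) (use A t(1-3) app(1-3) yc(1-3) in \<open>simp_all del: med_simps\<close>)
    qed (use A t(1-3) app(1-3) yc(1-3) in \<open>simp_all del: med_simps\<close>)
    show "approx B (Pr1 B) (Pr2 B) ?p (?app \<cdot> tup B ?x ?c) (?into A (Fm F (Fo (reindex B ?p f) X)))"
      unfolding re eq by (rule approx_refl[OF cf yc(1)])
  qed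
qed

end

theorem theorem4p17:
  fixes B :: "('o, 'm) flcat" and C :: "('o, 'm) flicat"
    and F :: "('o, 'm, 'm, 'm) func" and H :: "'m ifunc"
  assumes "pre_geminal B C F H"
  shows "(\<forall>D\<in>Ob B. code_structure B (Pr1 B) (Pr2 B) (dom_fibration B D) (dom_codes B C F H D)) \<and>
         code_structure B (Pr1 B) (Pr2 B) (cod_fibration B) (cod_codes B C F H)"
proof -
  interpret pre_geminal_category B C F H by unfold_locales fact
  show ?thesis using code_structure_dom code_structure_cod by blast
qed

end
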